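(* Let $p$ and $q$ be monic polynomials with degree $2$ of $\mathbb{F}[t]$ such that $p(0)q(0)\neq 0$. Assume that $p$ is irreducible over $\mathbb{F}$ and that $q$ splits over $\mathbb{F}$. Assume furthermore that $q$ has a double root or that $\operatorname{tr}(q)=\operatorname{tr}(p)=0$. Choose a root $y$ of $q$ in $\mathbb{F}$. Then, given an endomorphism $u$ of a finite-dimensional vector space $V$ over $\mathbb{F}$, the following conditions are equivalent: (i) $u$ is a q-exceptional $(p,q)$-quotient. (ii) The minimal polynomial of $u$ is a power of $H_y(p)$. (iii) In some basis of $V$, the endomorphism $u$ is represented by a block-diagonal matrix in which every diagonal block equals $C\bigl(H_y(p)^n\bigr)$ for some positive integer $n$.
   Context: $\mathbb{F}$ is an arbitrary field with algebraic closure $\overline{\mathbb{F}}$. For a monic polynomial $p$ of degree $n\ge 1$, $\operatorname{tr}(p)$ is the opposite of the coefficient of $p$ on $t^{n-1}$, and $\operatorname{Root}(p)$ is its set of roots in $\overline{\mathbb{F}}$. For $p$ monic of degree $2$ and $d\in\mathbb{F}\setminus\{0\}$, $H_d(p):=d^{-2}p(dt)$. An endomorphism $u$ of $V$ is a $(p,q)$-quotient if $u=ab^{-1}$ for some automorphisms $a,b$ of $V$ with $p(a)=0$ and $q(b)=0$. It is q-exceptional with respect to $(p,q)$ if all its eigenvalues in $\overline{\mathbb{F}}$ belong to $\operatorname{Root}(p)\operatorname{Root}(q)^{-1}=\{xy^{-1}: x\in\operatorname{Root}(p),\,y\in\operatorname{Root}(q)\}$; a q-exceptional $(p,q)$-quotient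 is a $(p,q)$-quotient that is q-exceptional with respect to $(p,q)$. $C(r)$ is the companion matrix of the monic polynomial $r$. *)

theory Defs
  imports
    "HOL-Algebra.Algebraic_Closure_Type"
    "Jordan_Normal_Form.Char_Poly"
begin

definition monic_poly :: "'a::field poly \<Rightarrow> bool" where
  "monic_poly r \<longleftrightarrow> lead_coeff r = 1"

definition splits :: "'a::field poly \<Rightarrow> bool" where
  "splits r \<longleftrightarrow> (\<exists>c A. r = smult c (\<Prod>x\<in>#A. [:-x, 1:]))"

definition poly_tr :: "'a::field poly \<Rightarrow> 'a" where
  "poly_tr r = - coeff r (degree r - 1)"

definition ac_roots :: "'a::field poly \<Rightarrow> 'a alg_closure set" where
  "ac_roots r = {x. poly (map_poly to_ac r) x = 0}"

text \<open>The polynomial \<open>d\<^sup>-\<^sup>2 r(d t)\<close>, which is monic when \<open>r\<close> is monic of degree 2.\<close>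
definition H_poly :: "'a::field \<Rightarrow> 'a poly \<Rightarrow> 'a poly" where
  "H_poly d r = smult (inverse (d\<^sup>2)) (pcompose r [:0, d:])"

text \<open>Subdiagonal of ones; the negated coefficients of \<open>r\<close> fill the last column.\<close>
definition companion_mat :: "'a::field poly \<Rightarrow> 'a mat" where
  "companion_mat r = mat (degree r) (degree r)
     (\<lambda>(i, j). if j = degree r - 1 then - coeff r i else if i = j + 1 then 1 else 0)"

text \<open>In what follows a vector space is given by its scalar multiplication \<open>scale\<close>, as in the locale
  \<^locale>\<open>vector_space\<close>.\<close>

definition endomorphism :: "('a::field \<Rightarrow> 'b::ab_group_add \<Rightarrow> 'b) \<Rightarrow> ('b \<Rightarrow> 'b) \<Rightarrow> bool" where
  "endomorphism scale u \<longleftrightarrow> Vector_Spaces.linear scale scale u"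

definition automorphism :: "('a::field \<Rightarrow> 'b::ab_group_add \<Rightarrow> 'b) \<Rightarrow> ('b \<Rightarrow> 'b) \<Rightarrow> bool" where
  "automorphism scale u \<longleftrightarrow> endomorphism scale u \<and> bij u"

definition poly_endo ::
    "('a::field \<Rightarrow> 'b::ab_group_add \<Rightarrow> 'b) \<Rightarrow> 'a poly \<Rightarrow> ('b \<Rightarrow> 'b) \<Rightarrow> 'b \<Rightarrow> 'b" where
  "poly_endo scale r u = (\<lambda>v. \<Sum>i\<le>degree r. scale (coeff r i) ((u ^^ i) v))"

definition annihilates ::
    "('a::field \<Rightarrow> 'b::ab_group_add \<Rightarrow> 'b) \<Rightarrow> 'a poly \<Rightarrow> ('b \<Rightarrow> 'b) \<Rightarrow> bool" where
  "annihilates scale r u \<longleftrightarrow> (\<forall>v. poly_endo scale r u v = 0)"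

text \<open>The monic generator of the ideal of annihilating polynomials; it equals 1 on the
  zero space, and it exists for every endomorphism of a finite-dimensional space.\<close>
definition minimal_polynomial ::
    "('a::field \<Rightarrow> 'b::ab_group_add \<Rightarrow> 'b) \<Rightarrow> ('b \<Rightarrow> 'b) \<Rightarrow> 'a poly" where
  "minimal_polynomial scale u =
     (THE m. monic_poly m \<and> (\<forall>r. annihilates scale r u \<longleftrightarrow> m dvd r))"

definition ordered_basis ::
    "('a::field \<Rightarrow> 'b::ab_group_add \<Rightarrow> 'b) \<Rightarrow> 'b list \<Rightarrow> bool" where
  "ordered_basis scale bs \<longleftrightarrow>
     distinct bs \<and> \<not> module.dependent scale (set bs) \<and> module.span scale (set bs) = UNIV"

text \<open>The \<open>j\<close>-th column holds the coordinates of the image of the \<open>j\<close>-th basis vector.\<close>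
definition matrix_in ::
    "('a::field \<Rightarrow> 'b::ab_group_add \<Rightarrow> 'b) \<Rightarrow> 'b list \<Rightarrow> ('b \<Rightarrow> 'b) \<Rightarrow> 'a mat" where
  "matrix_in scale bs u = mat (length bs) (length bs)
     (\<lambda>(i, j). module.representation scale (set bs) (u (bs ! j)) (bs ! i))"

text \<open>Eigenvalues in the algebraic closure are those of a representing matrix, read over the
  closure; they do not depend on the basis.\<close>
definition ac_eigenvalue ::
    "('a::field \<Rightarrow> 'b::ab_group_add \<Rightarrow> 'b) \<Rightarrow> ('b \<Rightarrow> 'b) \<Rightarrow> 'a alg_closure \<Rightarrow> bool" where
  "ac_eigenvalue scale u x \<longleftrightarrow>
     (\<exists>bs. ordered_basis scale bs \<and> eigenvalue (map_mat to_ac (matrix_in scale bs u)) x)"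

definition pq_quotient ::
    "('a::field \<Rightarrow> 'b::ab_group_add \<Rightarrow> 'b) \<Rightarrow> 'a poly \<Rightarrow> 'a poly \<Rightarrow> ('b \<Rightarrow> 'b) \<Rightarrow> bool" where
  "pq_quotient scale p q u \<longleftrightarrow>
     (\<exists>a b. automorphism scale a \<and> automorphism scale b
        \<and> annihilates scale p a \<and> annihilates scale q b
        \<and> u = a \<circ> inv_into UNIV b)"

definition q_exceptional ::
    "('a::field \<Rightarrow> 'b::ab_group_add \<Rightarrow> 'b) \<Rightarrow> 'a poly \<Rightarrow> 'a poly \<Rightarrow> ('b \<Rightarrow> 'b) \<Rightarrow> bool" where
  "q_exceptional scale p q u \<longleftrightarrow>
     (\<forall>z. ac_eigenvalue scale u z \<longrightarrow>
        z \<in> {x * inverse y |x y. x \<in> ac_roots p \<and> y \<in> ac_roots q})"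

definition q_exceptional_pq_quotient ::
    "('a::field \<Rightarrow> 'b::ab_group_add \<Rightarrow> 'b) \<Rightarrow> 'a poly \<Rightarrow> 'a poly \<Rightarrow> ('b \<Rightarrow> 'b) \<Rightarrow> bool" where
  "q_exceptional_pq_quotient scale p q u \<longleftrightarrow>
     pq_quotient scale p q u \<and> q_exceptional scale p q u"

end

theory Submission
  imports Defs
begin

text \<open>
  Set \<open>P = H\<^sub>y(p)\<close>. The hypotheses on \<open>q\<close> make \<open>Root(p) Root(q)\<^sup>-\<^sup>1\<close> the root set of \<open>P\<close>, so
  q-exceptionality already forces the characteristic polynomial of \<open>u\<close> to be a power of the
  irreducible \<open>P\<close>. A space killed by a power of \<open>P\<close> is a direct sum of cyclic modules
  \<open>F[t]/(P\<^sup>n)\<close>: a generating family of minimal total order has no relations. On each summand, with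
  generator \<open>w\<close>, the vectors \<open>e\<^sub>j = (P(u) u\<^sup>-\<^sup>1)\<^sup>j w\<close> and \<open>f\<^sub>j = u e\<^sub>j\<close> form a basis, in which \<open>b\<close> with
  \<open>u = a b\<^sup>-\<^sup>1\<close> can be written down.
\<close>

section \<open>Polynomials over a field\<close>

text \<open>The hypotheses on q say that its other root is y s with s = 1, or with s = -1 and tr p =
  0. The constructive step is from (iii) to (i). If P(u) = 0, then b = y id and a = y u suffice; for
  higher powers of P, b must absorb the nilpotent part of u. In characteristic 2 the polynomial P
  may be inseparable, and then u need not split over F into commuting semisimple and nilpotent
  parts. The basis e_j, f_j stands in for such a splitting. With P = t^2 - \<tau> t + \<delta> it
  gives u e_j = f_j and u f_j = \<tau> f_j - \<delta> e_j + f_(j+1), so u is C(P) on each plane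
  <e_j, f_j> plus the step from f_j to f_(j+1). As f_(j+1) = u e_(j+1), passing from f_j to f_j -
  e_(j+1) before applying u removes that step. Up to the scalars y s^j this passage is b, so a = u b
  acts on each plane as y s^j C(P). The signs s^j make the diagonal entries of b at f_j and e_(j+1)
  the two roots of q, and tr p = 0 keeps the trace of a on the planes independent of j.\<close>

lemma poly_ideal_generator:
  fixes I :: "'a::field poly set"
  assumes "r0 \<in> I" "r0 \<noteq> 0"
    and add: "\<And>r s. r \<in> I \<Longrightarrow> s \<in> I \<Longrightarrow> r + s \<in> I"
    and mult: "\<And>r s. s \<in> I \<Longrightarrow> r * s \<in> I"
  shows "\<exists>m. monic_poly m \<and> (\<forall>r. r \<in> I \<longleftrightarrow> m dvd r)"
proof -
  obtain m0 where m0: "m0 \<in> I" "m0 \<noteq> 0"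
    and min: "\<And>r. r \<in> I \<Longrightarrow> r \<noteq> 0 \<Longrightarrow> degree m0 \<le> degree r"
    using ex_has_least_nat[of "\<lambda>r. r \<in> I \<and> r \<noteq> 0" r0 degree] assms(1,2) by auto
  define c where "c = inverse (lead_coeff m0)"
  have c: "c \<noteq> 0" using m0 by (simp add: c_def)
  define m where "m = smult c m0"
  have "monic_poly m" using m0 by (simp add: m_def c_def monic_poly_def)
  have mI: "m \<in> I" using mult[OF m0(1), of "[:c:]"] by (simp add: m_def)
  have "m dvd r" if "r \<in> I" for r
  proof -
    have "m0 dvd r"
    proof (rule ccontr)
      assume "\<not> m0 dvd r"
      then have ne: "r mod m0 \<noteq> 0" by (simp add: mod_eq_0_iff_dvd)
      have "r mod m0 = r + (- (r div m0)) * m0"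
        by (simp add: minus_div_mult_eq_mod[symmetric])
      also have "\<dots> \<in> I" by (intro add mult that m0)
      finally have "degree m0 \<le> degree (r mod m0)" using min ne by blast
      moreover have "degree (r mod m0) < degree m0" using degree_mod_less[OF m0(2), of r] ne by auto
      ultimately show False by simp
    qed
    then show ?thesis by (simp add: m_def smult_dvd_iff c)
  qed
  moreover have "r \<in> I" if "m dvd r" for r
    using that mult[OF mI] by (metis dvdE mult.commute)
  ultimately show ?thesis using \<open>monic_poly m\<close> by blast
qed

text \<open>Says that every polynomial outside (P) is a unit modulo P^n. This is what allows
  generators to be exchanged and u to be inverted by a polynomial.\<close>

lemma irreducible_power_bezout:
  fixes P s :: "'a::field poly"
  assumes "irreducible P" "\<not> P dvd s"
  obtains a b where "a * s + b * P ^ n = 1"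
proof -
  have "\<exists>a b. a * s + b * P = 1"
  proof -
    define I where "I = {a * s + b * P |a b. True}"
    have mem: "x \<in> I \<longleftrightarrow> (\<exists>a b. x = a * s + b * P)" for x by (simp add: I_def)
    have "P \<in> I" unfolding mem by (rule exI[of _ 0], rule exI[of _ 1]) simp
    have "P \<noteq> 0" using assms(1) by auto
    have add: "x + z \<in> I" if "x \<in> I" "z \<in> I" for x z
    proof -
      from that obtain a b c d where "x = a * s + b * P" "z = c * s + d * P" unfolding mem by blast
      then have "x + z = (a + c) * s + (b + d) * P" by (simp add: algebra_simps)
      then show ?thesis unfolding mem by blast
    qed
    have mult: "x * z \<in> I" if "z \<in> I" for x z
    proof -
      from that obtain c d where "z = c * s + d * P" unfolding mem by blast
      then have "x * z = (x * c) * s + (x * d) * P" by (simp add: algebra_simps)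
      then show ?thesis unfolding mem by blast
    qed
    obtain m where m: "monic_poly m" "\<And>r. r \<in> I \<longleftrightarrow> m dvd r"
      using poly_ideal_generator[OF \<open>P \<in> I\<close> \<open>P \<noteq> 0\<close> add mult] by blast
    have mP: "m dvd P" using \<open>P \<in> I\<close> m by blast
    have "s \<in> I" unfolding mem by (rule exI[of _ 1], rule exI[of _ 0]) simp
    then have ms: "m dvd s" using m by blast
    have "\<not> P dvd m" using ms assms(2) dvd_trans by blast
    then have "m dvd 1" using assms(1) mP by (meson irreducibleD')
    then have "1 \<in> I" using m by blast
    then show ?thesis unfolding mem by metis
  qed
  then obtain a b where ab: "a * s + b * P = 1" by blast
  have "\<exists>a b. a * s + b * P ^ n = 1"
  proof (induction n)
    case 0
    show ?case by (rule exI[of _ 0], rule exI[of _ 1]) simp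
  next
    case (Suc n)
    then obtain c d where cd: "c * s + d * P ^ n = 1" by blast
    \<comment> \<open>In a s + b P = 1, the factor 1 hidden in b P * 1 is replaced by c s + d
      P^n.\<close>
    have "(a + b * P * c) * s + (b * d) * P ^ Suc n = a * s + b * P * (c * s + d * P ^ n)"
      by (simp add: algebra_simps)
    also have "\<dots> = 1" using ab cd by simp
    finally show ?case by blast
  qed
  then show thesis using that by blast
qed

lemma monic_unit_eq_1:
  fixes m :: "'a::field poly"
  assumes "monic_poly m" "m dvd 1"
  shows "m = 1"
proof -
  obtain c where "m = [:c:]" using assms(2) by (blast elim: is_unit_polyE)
  then show ?thesis using assms(1) by (simp add: monic_poly_def)
qed

lemma monic_poly_mult_cancel:
  "monic_poly m \<Longrightarrow> monic_poly (m * k) \<Longrightarrow> monic_poly k"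
  by (simp add: monic_poly_def lead_coeff_mult)

lemma monic_poly_power: "monic_poly m \<Longrightarrow> monic_poly (m ^ n)"
  by (simp add: monic_poly_def lead_coeff_power)

text \<open>Copies of P are split off while P divides m. Once it does not, m is a unit modulo the
  power of P that it divides, so m = 1.\<close>

lemma monic_dvd_irreducible_power:
  fixes P m :: "'a::field poly"
  assumes P: "irreducible P" "monic_poly P"
    and "monic_poly m" "m dvd P ^ n"
  shows "\<exists>k. m = P ^ k"
  using assms(3,4)
proof (induction n arbitrary: m)
  case 0
  then show ?case using monic_unit_eq_1[of m] by (intro exI[of _ 0]) simp
next
  case (Suc n)
  show ?case
  proof (cases "P dvd m")
    case True
    then obtain k where k: "m = P * k" by (rule dvdE)
    then have "k dvd P ^ n" using Suc.prems(2) P(1) by auto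
    moreover have "monic_poly k" using Suc.prems(1) P(2) k monic_poly_mult_cancel by blast
    ultimately obtain j where "k = P ^ j" using Suc.IH by blast
    then show ?thesis using k by (intro exI[of _ "Suc j"]) simp
  next
    case False
    obtain a b where "a * m + b * P ^ Suc n = 1" using irreducible_power_bezout[OF P(1) False] .
    then have "m dvd 1" using Suc.prems(2) by (metis dvd_add dvd_mult dvd_refl)
    then show ?thesis using Suc.prems(1) monic_unit_eq_1[of m] by (intro exI[of _ 0]) simp
  qed
qed

lemma monic_dvd_antisym:
  fixes m k :: "'a::field poly"
  assumes "monic_poly m" "monic_poly k" "m dvd k" "k dvd m"
  shows "m = k"
  using assms(1,2) by (intro poly_dvd_antisym assms(3,4)) (simp only: monic_poly_def)

lemma monic_irreducible_factor:
  fixes r :: "'a::field poly"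
  assumes "degree r > 0"
  obtains Q where "irreducible Q" "monic_poly Q" "Q dvd r"
proof -
  have "\<exists>Q. irreducible Q \<and> Q dvd r" using assms
  proof (induction "degree r" arbitrary: r rule: less_induct)
    case less
    show ?case
    proof (cases "irreducible r")
      case False
      have "r \<noteq> 0" "\<not> r dvd 1" using less.prems by (auto simp: is_unit_iff_degree)
      with False obtain a b where ab: "r = a * b" "\<not> a dvd 1" "\<not> b dvd 1"
        unfolding irreducible_def by blast
      then have "a \<noteq> 0" "b \<noteq> 0" using \<open>r \<noteq> 0\<close> by auto
      then have "0 < degree a" "0 < degree b" "degree r = degree a + degree b"
        using ab by (auto simp: is_unit_iff_degree degree_mult_eq)
      then obtain Q where "irreducible Q" "Q dvd a" using less.hyps[of a] by auto
      then show ?thesis using ab by auto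
    qed auto
  qed
  then obtain Q where Q: "irreducible Q" "Q dvd r" by blast
  then have "Q \<noteq> 0" by auto
  define c where "c = inverse (lead_coeff Q)"
  have c: "c \<noteq> 0" using \<open>Q \<noteq> 0\<close> by (simp add: c_def)
  have "irreducible (smult c Q)"
    using Q(1) c irreducible_mult_unit_left[of "[:c:]" Q] by (simp add: is_unit_pCons_iff)
  moreover have "monic_poly (smult c Q)" using \<open>Q \<noteq> 0\<close> by (simp add: c_def monic_poly_def)
  moreover have "smult c Q dvd r" using Q(2) c by (simp add: smult_dvd_iff)
  ultimately show thesis by (rule that)
qed

lemma monic_eq_irreducible_power:
  fixes r P :: "'a::field poly"
  assumes "monic_poly r" "\<And>Q. irreducible Q \<Longrightarrow> monic_poly Q \<Longrightarrow> Q dvd r \<Longrightarrow> Q = P"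
  shows "\<exists>k. r = P ^ k"
  using assms
proof (induction "degree r" arbitrary: r rule: less_induct)
  case less
  show ?case
  proof (cases "degree r = 0")
    case True
    then obtain c where "r = [:c:]" by (auto elim: degree_eq_zeroE)
    then have "r = 1" using less.prems(1) by (simp add: monic_poly_def)
    then show ?thesis by (intro exI[of _ 0]) simp
  next
    case False
    then obtain Q where Q: "irreducible Q" "monic_poly Q" "Q dvd r"
      using monic_irreducible_factor[of r] by blast
    then have "Q = P" using less.prems(2) by blast
    with Q obtain k where k: "r = P * k" by blast
    have mk: "monic_poly k" using less.prems(1) Q(2) \<open>Q = P\<close> k monic_poly_mult_cancel by blast
    have "\<not> P dvd 1" using Q(1) \<open>Q = P\<close> unfolding irreducible_def by blast
    moreover have "P \<noteq> 0" "k \<noteq> 0" using Q(2) mk \<open>Q = P\<close> by (auto simp: monic_poly_def)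
    ultimately have "degree k < degree r" using k by (simp add: degree_mult_eq is_unit_iff_degree)
    then obtain j where "k = P ^ j" using less.hyps[of k] mk less.prems(2) k by auto
    then show ?thesis using k by (intro exI[of _ "Suc j"]) simp
  qed
qed

section \<open>Roots in the algebraic closure\<close>

global_interpretation to_ac_hom: inj_comm_ring_hom to_ac
  by unfold_locales auto

global_interpretation to_ac_poly_hom: map_poly_inj_comm_ring_hom to_ac ..

text \<open>If P did not divide Q, a Bezout identity evaluated at the common root would read 0 = 1.
  Irreducibility of Q then gives the converse divisibility.\<close>

lemma irreducible_common_root_eq:
  fixes P Q :: "'a::field poly"
  assumes "irreducible P" "monic_poly P" "irreducible Q" "monic_poly Q"
    and "poly (map_poly to_ac P) z = 0" "poly (map_poly to_ac Q) z = 0"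
  shows "Q = P"
proof -
  have "P dvd Q"
  proof (rule ccontr)
    assume "\<not> P dvd Q"
    then obtain a b where ab: "a * Q + b * P ^ 1 = 1" using irreducible_power_bezout assms(1) by blast
    have "poly (map_poly to_ac (a * Q + b * P ^ 1)) z = 0"
      using assms(5,6) by (simp add: to_ac_poly_hom.hom_add to_ac_poly_hom.hom_mult)
    then show False unfolding ab by simp
  qed
  moreover have "Q dvd P"
  proof (rule ccontr)
    assume "\<not> Q dvd P"
    then have "P dvd 1" using \<open>P dvd Q\<close> irreducibleD'[OF assms(3)] by blast
    then show False using assms(1) unfolding irreducible_def by blast
  qed
  ultimately show ?thesis using assms monic_dvd_antisym by blast
qed

lemma ac_root_exists:
  fixes Q :: "'a::field poly"
  assumes "irreducible Q"
  obtains z where "poly (map_poly to_ac Q) z = 0"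
proof -
  have "Q \<noteq> 0" "\<not> Q dvd 1" using assms unfolding irreducible_def by blast+
  then have "degree Q > 0" by (simp add: is_unit_iff_degree)
  then have "degree (map_poly to_ac Q) > 0" by simp
  then obtain z where "poly (map_poly to_ac Q) z = 0" using alg_closed_imp_poly_has_root by blast
  then show thesis by (rule that)
qed

section \<open>The polynomial action of an endomorphism\<close>

text \<open>Interpreted later at \<open>a\<close> and \<open>b\<close> as well as at
  \<open>u\<close>, so that all three share one polynomial calculus.\<close>

locale fd_endo = finite_dimensional_vector_space scale Basis
  for scale :: "'a::field \<Rightarrow> 'b::ab_group_add \<Rightarrow> 'b" (infixr \<open>*s\<close> 75) and Basis :: "'b set" +
  fixes u :: "'b \<Rightarrow> 'b"
  assumes linear_u: "Vector_Spaces.linear scale scale u"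
begin

sublocale u: Vector_Spaces.linear scale scale u by (rule linear_u)

abbreviation act :: "'a poly \<Rightarrow> 'b \<Rightarrow> 'b" where
  "act r \<equiv> poly_endo scale r u"

text \<open>A summation bound above the degree lets polynomials of different degrees be added over
  one index range.\<close>

lemma act_eq_sum:
  assumes "degree r \<le> n"
  shows "act r v = (\<Sum>i\<le>n. coeff r i *s (u ^^ i) v)"
  unfolding poly_endo_def
  by (rule sum.mono_neutral_left) (use assms in \<open>auto simp: coeff_eq_0\<close>)

lemma act_pCons: "act (pCons a r) v = a *s v + u (act r v)"
proof -
  have "act (pCons a r) v = (\<Sum>i\<le>Suc (degree r). coeff (pCons a r) i *s (u ^^ i) v)"
    by (rule act_eq_sum) (rule degree_pCons_le)
  also have "\<dots> = a *s v + (\<Sum>i\<le>degree r. coeff r i *s u ((u ^^ i) v))"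
    by (subst sum.atMost_Suc_shift) simp
  also have "\<dots> = a *s v + u (act r v)"
    by (simp add: poly_endo_def u.sum u.scale)
  finally show ?thesis .
qed

lemma act_0 [simp]: "act 0 v = 0"
  by (simp add: poly_endo_def)

lemma act_const [simp]: "act [:c:] v = c *s v"
  by (simp add: act_pCons u.zero)

lemma act_1 [simp]: "act 1 v = v"
  using act_const[of 1 v] unfolding pCons_one by simp

lemma act_X [simp]: "act [:0, 1:] v = u v"
  by (simp add: act_pCons)

lemma act_add: "act (r + s) v = act r v + act s v"
proof -
  define n where "n = max (degree r) (degree s)"
  have "degree r \<le> n" "degree s \<le> n" "degree (r + s) \<le> n"
    by (auto simp: n_def degree_add_le)
  then show ?thesis
    by (simp add: act_eq_sum[of _ n] scale_left_distrib sum.distrib)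
qed

lemma act_smult: "act (smult c r) v = c *s act r v"
  by (induction r) (simp_all add: act_pCons scale_right_distrib u.scale)

lemma act_mult: "act (r * s) v = act r (act s v)"
  by (induction r) (simp_all add: act_pCons act_add act_smult u.add)

lemma act_uminus: "act (- r) v = - act r v"
  using act_smult[of "-1" r v] by simp

lemma act_diff: "act (r - s) v = act r v - act s v"
  using act_add[of r "- s" v] by (simp add: act_uminus)

lemma act_sum: "act (\<Sum>i\<in>I. r i) v = (\<Sum>i\<in>I. act (r i) v)"
  by (induction I rule: infinite_finite_induct) (simp_all add: act_add)

lemma linear_act: "Vector_Spaces.linear scale scale (act r)"
proof -
  have "act r (x + y) = act r x + act r y \<and> act r (c *s x) = c *s act r x" for x y c
    by (induction r) (simp_all add: act_pCons scale_right_distrib u.add u.scale algebra_simps)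
  then show ?thesis
    by (auto intro!: Vector_Spaces.linear.intro module_hom.intro module_hom_axioms.intro
        module_axioms vector_space_axioms)
qed

sublocale act: Vector_Spaces.linear scale scale "act r" for r by (rule linear_act)

lemma act_power_u: "act ([:0, 1:] ^ n) v = (u ^^ n) v"
  by (induction n) (simp_all add: act_mult act_pCons)

lemma annihilates_if_spanning:
  assumes "span S = UNIV" "\<And>v. v \<in> S \<Longrightarrow> act r v = 0"
  shows "annihilates scale r u"
  unfolding annihilates_def
proof
  fix v
  have "v \<in> span S" using assms(1) by simp
  then show "act r v = 0"
    by (induction rule: span_induct_alt) (simp_all add: act.add act.scale act.zero assms(2))
qed

text \<open>Writing r = c + t s, the relation r(u) = 0 reads u s(u) = -c. Hence - s(u) / c is a
  two-sided inverse, because it commutes with u.\<close>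

lemma bij_if_annihilated:
  assumes "annihilates scale r u" "poly r 0 \<noteq> 0"
  shows "bij u"
proof -
  obtain c s where r: "r = pCons c s" by (cases r)
  have c: "c \<noteq> 0" using assms(2) r by simp
  have e: "c *s v + u (act s v) = 0" for v
    using assms(1) by (simp add: annihilates_def r act_pCons)
  define g where "g v = (- inverse c) *s act s v" for v
  have 1: "u (g v) = v" for v
  proof -
    have "u (act s v) = - (c *s v)" using e[of v] by (simp add: eq_neg_iff_add_eq_0 add.commute)
    then show ?thesis using c by (simp add: g_def u.neg u.scale)
  qed
  have "act s (u v) = u (act s v)" for v
    using act_mult[of s "[:0,1:]" v] act_mult[of "[:0,1:]" s v] by (simp add: mult.commute)
  then have "g (u v) = u (g v)" for v by (simp add: g_def u.scale u.neg)
  with 1 show ?thesis by (intro o_bij[of g]) auto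
qed

section \<open>Independent families, representing matrices and the minimal polynomial\<close>

lemma family_independentD:
  assumes "finite I" "inj_on g I" "independent (g ` I)" "(\<Sum>i\<in>I. c i *s g i) = 0" "i \<in> I"
  shows "c i = 0"
proof -
  have "(\<Sum>v\<in>g ` I. c (inv_into I g v) *s v) = (\<Sum>i\<in>I. c i *s g i)"
    using assms(2) by (subst sum.reindex) auto
  then have "c (inv_into I g (g i)) = 0"
    using independentD[OF assms(3), of "g ` I" "\<lambda>v. c (inv_into I g v)" "g i"] assms by auto
  then show ?thesis using assms by simp
qed

text \<open>\<open>independent\<close> speaks of a set and cannot see repetitions in a family. The
  condition on coefficients can: a repetition g i = g j yields the relation with coefficients 1 and
  -1.\<close>

lemma family_independentI:
  assumes "finite I" "\<And>c i. (\<Sum>i\<in>I. c i *s g i) = 0 \<Longrightarrow> i \<in> I \<Longrightarrow> c i = 0"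
  shows "inj_on g I" "independent (g ` I)"
proof -
  show inj: "inj_on g I"
  proof (rule inj_onI, rule ccontr)
    fix i j assume ij: "i \<in> I" "j \<in> I" "g i = g j" "i \<noteq> j"
    define c :: "_ \<Rightarrow> 'a" where "c k = (if k = i then 1 else if k = j then - 1 else 0)" for k
    have "(\<Sum>k\<in>I. c k *s g k) = (\<Sum>k\<in>{i, j}. c k *s g k)"
      by (rule sum.mono_neutral_right) (use assms(1) ij in \<open>auto simp: c_def\<close>)
    also have "\<dots> = 0" using ij by (simp add: c_def)
    finally have "c i = 0" using assms(2) ij by blast
    then show False by (simp add: c_def)
  qed
  show "independent (g ` I)"
  proof (rule independent_if_scalars_zero)
    fix f x assume "(\<Sum>x\<in>g ` I. f x *s x) = 0" "x \<in> g ` I"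
    then show "f x = 0"
      using assms(2)[of "\<lambda>i. f (g i)"] inj by (auto simp: sum.reindex)
  qed (use assms(1) in simp)
qed

lemma ordered_basis_exists: "\<exists>bs. ordered_basis scale bs"
proof -
  obtain bs where "set bs = Basis" "distinct bs" using finite_distinct_list[OF finite_Basis] by blast
  then show ?thesis using independent_Basis span_Basis by (auto simp: ordered_basis_def)
qed

lemma ordered_basisD:
  assumes "ordered_basis scale bs"
  shows "distinct bs" "independent (set bs)" "span (set bs) = UNIV"
  using assms by (auto simp: ordered_basis_def)

lemma ordered_basis_nth_inj:
  assumes "ordered_basis scale bs"
  shows "inj_on ((!) bs) {..<length bs}" "(!) bs ` {..<length bs} = set bs"
  using ordered_basisD(1)[OF assms] by (auto simp: inj_on_def nth_eq_iff_index_eq in_set_conv_nth)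

lemma ordered_basis_coeff_0:
  assumes "ordered_basis scale bs" "(\<Sum>i<length bs. c i *s bs ! i) = 0" "i < length bs"
  shows "c i = 0"
  using family_independentD[of "{..<length bs}" "(!) bs" c i] ordered_basis_nth_inj[OF assms(1)]
    ordered_basisD[OF assms(1)] assms(2,3) by simp

text \<open>The column relations alone, for a list that need not be a basis. Thus they can be stated
  for the two parts of \<open>xs @ ys\<close>, neither of which has to span.\<close>

definition represents :: "'b list \<Rightarrow> 'a mat \<Rightarrow> bool" where
  "represents bs M \<longleftrightarrow> M \<in> carrier_mat (length bs) (length bs) \<and>
     (\<forall>j<length bs. u (bs ! j) = (\<Sum>i<length bs. M $$ (i, j) *s bs ! i))"

lemma sum_representation_ordered_basis:
  assumes "ordered_basis scale bs"
  shows "(\<Sum>i<length bs. representation (set bs) v (bs ! i) *s bs ! i) = v"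
proof -
  have "(\<Sum>i<length bs. representation (set bs) v (bs ! i) *s bs ! i)
      = (\<Sum>b\<in>set bs. representation (set bs) v b *s b)"
    by (rule sum.reindex_bij_betw, rule bij_betw_nth)
      (use ordered_basisD(1)[OF assms] in auto)
  also have "\<dots> = v"
    by (rule sum_representation_eq) (use ordered_basisD[OF assms] in auto)
  finally show ?thesis .
qed

lemma represents_matrix_in:
  assumes "ordered_basis scale bs"
  shows "represents bs (matrix_in scale bs u)"
  by (simp add: represents_def matrix_in_def sum_representation_ordered_basis[OF assms])

lemma matrix_in_eq_iff:
  assumes "ordered_basis scale bs"
  shows "matrix_in scale bs u = M \<longleftrightarrow> represents bs M"
proof
  assume M: "represents bs M"
  let ?N = "matrix_in scale bs u"
  note N = represents_matrix_in[OF assms]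
  show "?N = M"
  proof (rule eq_matI)
    fix i j assume "i < dim_row M" "j < dim_col M"
    then have ij: "i < length bs" "j < length bs" using M by (auto simp: represents_def)
    have 0: "(\<Sum>i<length bs. (?N $$ (i, j) - M $$ (i, j)) *s bs ! i) = 0"
      using N M ij by (simp add: represents_def scale_left_diff_distrib sum_subtractf)
    have "?N $$ (i, j) - M $$ (i, j) = 0" by (rule ordered_basis_coeff_0[OF assms 0 ij(1)])
    then show "?N $$ (i, j) = M $$ (i, j)" by simp
  qed (use M N in \<open>auto simp: represents_def\<close>)
qed (use represents_matrix_in[OF assms] in blast)

text \<open>With B = t I - M over F[t], the column relations of M say that the sum over i of B_ij(u)
  b_i is zero for each j. If A is the adjugate of B, then B A is the characteristic polynomial times
  the identity; combining these relations with the coefficients A_jk(u) therefore gives the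
  characteristic polynomial of u applied to b_k.\<close>

lemma cayley_hamilton:
  assumes "ordered_basis scale bs"
  shows "annihilates scale (char_poly (matrix_in scale bs u)) u"
proof -
  let ?n = "length bs" and ?M = "matrix_in scale bs u"
  define B where "B = char_poly_matrix ?M"
  define A where "A = adj_mat B"
  note M = represents_matrix_in[OF assms]
  have MC: "?M \<in> carrier_mat ?n ?n" using M by (simp add: represents_def)
  then have BC: "B \<in> carrier_mat ?n ?n" by (simp add: B_def)
  have AC: "A \<in> carrier_mat ?n ?n" and BA: "B * A = char_poly ?M \<cdot>\<^sub>m 1\<^sub>m ?n"
    using adj_mat[OF BC] by (simp_all add: A_def B_def char_poly_def)
  have Bij: "B $$ (i, j) = (if i = j then [:0, 1:] else 0) - [:?M $$ (i, j):]"
    if "i < ?n" "j < ?n" for i j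
    using that MC by (simp add: B_def char_poly_matrix_def)
  have B0: "(\<Sum>i<?n. act (B $$ (i, j)) (bs ! i)) = 0" if j: "j < ?n" for j
  proof -
    have "(\<Sum>i<?n. act (B $$ (i, j)) (bs ! i))
        = (\<Sum>i<?n. (if i = j then u (bs ! i) else 0) - ?M $$ (i, j) *s bs ! i)"
      using j by (intro sum.cong) (auto simp: Bij act_diff)
    also have "\<dots> = u (bs ! j) - (\<Sum>i<?n. ?M $$ (i, j) *s bs ! i)"
      using j by (simp add: sum_subtractf)
    also have "\<dots> = 0" using M j by (simp add: represents_def)
    finally show ?thesis .
  qed
  have chi0: "act (char_poly ?M) (bs ! k) = 0" if k: "k < ?n" for k
  proof -
    have "act (char_poly ?M) (bs ! k)
        = (\<Sum>i<?n. if i = k then act (char_poly ?M) (bs ! i) else 0)"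
      using k by simp
    also have "\<dots> = (\<Sum>i<?n. act ((B * A) $$ (i, k)) (bs ! i))"
      using k by (intro sum.cong) (auto simp: BA)
    also have "\<dots> = (\<Sum>i<?n. \<Sum>j<?n. act (A $$ (j, k)) (act (B $$ (i, j)) (bs ! i)))"
      using k AC BC
      by (intro sum.cong) (auto simp: scalar_prod_def act_sum act_mult mult.commute[of "B $$ _"]
          lessThan_atLeast0)
    also have "\<dots> = (\<Sum>j<?n. act (A $$ (j, k)) (\<Sum>i<?n. act (B $$ (i, j)) (bs ! i)))"
      by (subst sum.swap) (simp add: act.sum)
    also have "\<dots> = 0" by (simp add: B0 act.zero)
    finally show ?thesis .
  qed
  show ?thesis
    by (rule annihilates_if_spanning[OF ordered_basisD(3)[OF assms]])
      (auto simp: in_set_conv_nth chi0)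
qed

lemma monic_char_poly:
  assumes "ordered_basis scale bs"
  shows "monic_poly (char_poly (matrix_in scale bs u))"
  using degree_monic_char_poly[of "matrix_in scale bs u" "length bs"]
    represents_matrix_in[OF assms] by (simp add: represents_def monic_poly_def)

text \<open>Justifies the definite description: the annihilating polynomials form an ideal, nonzero
  by Cayley-Hamilton, and two monic generators divide each other.\<close>

lemma minimal_polynomial_props:
  shows "monic_poly (minimal_polynomial scale u)"
    and "annihilates scale r u \<longleftrightarrow> minimal_polynomial scale u dvd r"
proof -
  obtain bs where bs: "ordered_basis scale bs" using ordered_basis_exists by blast
  have "char_poly (matrix_in scale bs u) \<noteq> 0"
    using monic_char_poly[OF bs] by (auto simp: monic_poly_def)
  then have "\<exists>m. monic_poly m \<and> (\<forall>r. r \<in> {r. annihilates scale r u} \<longleftrightarrow> m dvd r)"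
    using cayley_hamilton[OF bs]
    by (intro poly_ideal_generator[of "char_poly (matrix_in scale bs u)"])
      (auto simp: annihilates_def act_add act_mult act.zero)
  then obtain m where m: "monic_poly m" "\<And>r. annihilates scale r u \<longleftrightarrow> m dvd r" by auto
  have "minimal_polynomial scale u = m"
    unfolding minimal_polynomial_def
  proof (rule the_equality)
    fix k assume "monic_poly k \<and> (\<forall>r. annihilates scale r u = (k dvd r))"
    then show "k = m" using m monic_dvd_antisym by (meson dvd_refl)
  qed (use m in blast)
  then show "monic_poly (minimal_polynomial scale u)"
    "annihilates scale r u \<longleftrightarrow> minimal_polynomial scale u dvd r" using m by auto
qed

text \<open>A left eigenvector over the closure turns \<open>u\<close> into multiplication by the eigenvalue.\<close>
lemma ac_eigenvalue_root:
  assumes "ac_eigenvalue scale u z" "annihilates scale r u"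
  shows "poly (map_poly to_ac r) z = 0"
proof -
  obtain bs where bs: "ordered_basis scale bs"
    and ev: "eigenvalue (map_mat to_ac (matrix_in scale bs u)) z"
    using assms(1) by (auto simp: ac_eigenvalue_def)
  let ?n = "length bs" and ?M = "matrix_in scale bs u"
  note M = represents_matrix_in[OF bs]
  have MC: "map_mat to_ac ?M \<in> carrier_mat ?n ?n" using M by (simp add: represents_def)
  have "eigenvalue (transpose_mat (map_mat to_ac ?M)) z"
    using ev MC by (simp add: eigenvalue_root_char_poly[of _ ?n])
  then obtain w where w: "w \<in> carrier_vec ?n" "w \<noteq> 0\<^sub>v ?n"
    and wz: "transpose_mat (map_mat to_ac ?M) *\<^sub>v w = z \<cdot>\<^sub>v w"
    using MC by (auto simp: eigenvalue_def eigenvector_def)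
  \<comment> \<open>An F-linear map from V to the closure. Taking the eigenvector on the left makes
    this a form on V itself with \<phi> (u v) = z \<phi> v, so that V is never extended to the
    closure.\<close>
  define \<phi> where "\<phi> v = (\<Sum>i<?n. to_ac (representation (set bs) v (bs ! i)) * w $ i)" for v
  have span: "v \<in> span (set bs)" for v using ordered_basisD(3)[OF bs] by simp
  note ind = ordered_basisD(2)[OF bs]
  have \<phi>_add: "\<phi> (x + y) = \<phi> x + \<phi> y" for x y
    by (simp add: \<phi>_def representation_add[OF ind span span] distrib_right sum.distrib)
  have \<phi>_scale: "\<phi> (c *s x) = to_ac c * \<phi> x" for c x
    by (simp add: \<phi>_def representation_scale[OF ind span] sum_distrib_left mult.assoc)
  have \<phi>_bs: "\<phi> (bs ! j) = w $ j" if j: "j < ?n" for j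
  proof -
    have "\<phi> (bs ! j) = (\<Sum>i<?n. if i = j then w $ i else 0)"
      unfolding \<phi>_def using j ordered_basisD(1)[OF bs]
      by (intro sum.cong) (auto simp: representation_basis[OF ind] nth_eq_iff_index_eq)
    then show ?thesis using j by simp
  qed
  have \<phi>_0: "\<phi> 0 = 0" using \<phi>_scale[of 0 0] by simp
  have \<phi>_sum: "\<phi> (\<Sum>i\<in>I. f i) = (\<Sum>i\<in>I. \<phi> (f i))" for I :: "nat set" and f
    by (induction I rule: infinite_finite_induct) (simp_all add: \<phi>_0 \<phi>_add)
  have \<phi>_u_bs: "\<phi> (u (bs ! j)) = z * \<phi> (bs ! j)" if j: "j < ?n" for j
  proof -
    have "\<phi> (u (bs ! j)) = (\<Sum>i<?n. to_ac (?M $$ (i, j)) * w $ i)"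
      using M j by (simp add: represents_def \<phi>_sum \<phi>_scale \<phi>_bs)
    also have "\<dots> = (transpose_mat (map_mat to_ac ?M) *\<^sub>v w) $ j"
      using M w j by (auto simp: represents_def scalar_prod_def lessThan_atLeast0 intro!: sum.cong)
    also have "\<dots> = z * w $ j" using w j by (simp add: wz)
    finally show ?thesis using j by (simp add: \<phi>_bs)
  qed
  have \<phi>_u: "\<phi> (u v) = z * \<phi> v" for v
    using span[of v]
    by (induction rule: span_induct_alt)
      (auto simp: \<phi>_0 u.zero u.add u.scale \<phi>_add \<phi>_scale \<phi>_u_bs in_set_conv_nth algebra_simps)
  have \<phi>_act: "\<phi> (act s v) = poly (map_poly to_ac s) z * \<phi> v" for s v
    by (induction s) (simp_all add: \<phi>_0 act_pCons \<phi>_add \<phi>_scale \<phi>_u to_ac_hom.map_poly_pCons_hom algebra_simps)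
  have "\<exists>j<?n. w $ j \<noteq> 0"
  proof (rule ccontr)
    assume "\<not> ?thesis"
    then have "w = 0\<^sub>v ?n" using w(1) by (intro eq_vecI) auto
    then show False using w(2) by simp
  qed
  then obtain j where "j < ?n" "w $ j \<noteq> 0" by blast
  then show ?thesis using \<phi>_act[of r "bs ! j"] assms(2) by (simp add: annihilates_def \<phi>_0 \<phi>_bs)
qed

lemma ac_eigenvalue_char_poly:
  assumes "ordered_basis scale bs" "poly (map_poly to_ac (char_poly (matrix_in scale bs u))) z = 0"
  shows "ac_eigenvalue scale u z"
proof -
  have MC: "matrix_in scale bs u \<in> carrier_mat (length bs) (length bs)"
    using represents_matrix_in[OF assms(1)] by (simp add: represents_def)
  then have "eigenvalue (map_mat to_ac (matrix_in scale bs u)) z"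
    using assms(2) by (simp add: eigenvalue_root_char_poly[of _ "length bs"] to_ac_hom.char_poly_hom)
  then show ?thesis using assms(1) by (auto simp: ac_eigenvalue_def)
qed

text \<open>An irreducible factor of the characteristic polynomial has a root in the closure. That
  root is an eigenvalue, hence a root of P, so the factor is P.\<close>

lemma minimal_polynomial_irreducible_power:
  assumes P: "irreducible P" "monic_poly P"
    and ev: "\<And>z. ac_eigenvalue scale u z \<Longrightarrow> poly (map_poly to_ac P) z = 0"
  shows "\<exists>n. minimal_polynomial scale u = P ^ n"
proof -
  obtain bs where bs: "ordered_basis scale bs" using ordered_basis_exists by blast
  let ?r = "char_poly (matrix_in scale bs u)"
  have "\<exists>k. ?r = P ^ k"
  proof (rule monic_eq_irreducible_power)
    fix Q assume Q: "irreducible Q" "monic_poly Q" "Q dvd ?r"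
    obtain z where z: "poly (map_poly to_ac Q) z = 0" using ac_root_exists[OF Q(1)] .
    obtain s where "?r = Q * s" using Q(3) by (rule dvdE)
    then have "poly (map_poly to_ac ?r) z = 0" using z by (simp add: to_ac_poly_hom.hom_mult)
    then have "poly (map_poly to_ac P) z = 0" using ev ac_eigenvalue_char_poly[OF bs] by blast
    then show "Q = P" using irreducible_common_root_eq P Q z by blast
  qed (rule monic_char_poly[OF bs])
  then obtain k where "?r = P ^ k" by blast
  then have "minimal_polynomial scale u dvd P ^ k"
    using cayley_hamilton[OF bs] minimal_polynomial_props(2) by simp
  then show ?thesis using monic_dvd_irreducible_power[OF P] minimal_polynomial_props(1) by blast
qed

end

section \<open>Cyclic decomposition\<close>

lemma sum_lessThan_append:
  fixes f :: "nat \<Rightarrow> 'c::comm_monoid_add"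
  shows "sum f {..<a + b} = sum f {..<a} + (\<Sum>i<b. f (a + i))"
  by (induction b) (simp_all add: add.assoc)

lemma all_less_add_iff: "(\<forall>j<a + b. Q j) \<longleftrightarrow> (\<forall>j<a. Q j) \<and> (\<forall>j<(b::nat). Q (a + j))"
  by (metis add_less_cancel_left le_add_diff_inverse not_less trans_less_add1)

context fd_endo
begin

text \<open>The exponents are only upper bounds for the orders of the generators. The number k stays
  fixed while exponents shrink, and exponent 0 marks a generator that has become zero.\<close>

definition gens :: "'a poly \<Rightarrow> nat \<Rightarrow> (nat \<Rightarrow> 'b) \<Rightarrow> (nat \<Rightarrow> nat) \<Rightarrow> bool" where
  "gens P k v n \<longleftrightarrow> (\<forall>i<k. act (P ^ n i) (v i) = 0) \<and> (\<forall>x. \<exists>r. x = (\<Sum>i<k. act (r i) (v i)))"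

lemma gens_exist:
  assumes "annihilates scale (P ^ N) u"
  shows "\<exists>k v. gens P k v (\<lambda>_. N)"
proof -
  obtain bs where bs: "ordered_basis scale bs" using ordered_basis_exists by blast
  have "\<exists>r. x = (\<Sum>i<length bs. act (r i) (bs ! i))" for x
    by (rule exI[of _ "\<lambda>i. [:representation (set bs) x (bs ! i):]"])
      (simp add: sum_representation_ordered_basis[OF bs])
  then have "gens P (length bs) ((!) bs) (\<lambda>_. N)"
    using assms by (simp add: gens_def annihilates_def)
  then show ?thesis by blast
qed

text \<open>A nontrivial relation among generators, divided by the largest power of \<open>P\<close> common to its
  essential coefficients, lets one generator be replaced by one of smaller order; a
  generating family of minimal total order is therefore free.\<close>
lemma gens_free:
  assumes P: "irreducible P" and "gens P k v n"
  shows "\<exists>v n. gens P k v n \<and>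
    (\<forall>r i. (\<Sum>i<k. act (r i) (v i)) = 0 \<longrightarrow> i < k \<longrightarrow> P ^ n i dvd r i)"
  using assms(2)
proof (induction "\<Sum>i<k. n i" arbitrary: v n rule: less_induct)
  case less
  show ?case
  proof (cases "\<forall>r i. (\<Sum>i<k. act (r i) (v i)) = 0 \<longrightarrow> i < k \<longrightarrow> P ^ n i dvd r i")
    case True
    then show ?thesis using less.prems by blast
  next
    case False
    then obtain r i1 where rel: "(\<Sum>i<k. act (r i) (v i)) = 0"
      and i1: "i1 < k" "\<not> P ^ n i1 dvd r i1" by blast
    \<comment> \<open>Indices outside \<open>bad\<close> contribute zero to the relation.\<close>
    define bad where "bad = {i. i < k \<and> \<not> P ^ n i dvd r i}"
    have "n i1 \<noteq> 0" using i1(2) by (intro notI) simp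
    then have "\<exists>i\<in>bad. \<not> P ^ Suc (n i1 - 1) dvd r i"
      using i1 by (intro bexI[of _ i1]) (simp_all add: bad_def)
    \<comment> \<open>This m is the largest exponent for which P^m divides all the coefficients with
      index in \<open>bad\<close>.\<close>
    then obtain m where "\<exists>i\<in>bad. \<not> P ^ Suc m dvd r i"
      and least: "\<And>j. j < m \<Longrightarrow> \<not> (\<exists>i\<in>bad. \<not> P ^ Suc j dvd r i)"
      by (metis (no_types, lifting) exists_least_iff[of "\<lambda>m. \<exists>i\<in>bad. \<not> P ^ Suc m dvd r i"])
    then obtain i0 where i0: "i0 \<in> bad" "\<not> P ^ Suc m dvd r i0" by blast
    have i0k: "i0 < k" using i0 by (simp add: bad_def)
    have Pm: "P ^ m dvd r i" if "i \<in> bad" for i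
    proof (cases m)
      case (Suc j)
      then show ?thesis using least[of j] that by auto
    qed simp
    have m_less: "m < n i0"
    proof (rule ccontr)
      assume "\<not> m < n i0"
      then have "P ^ n i0 dvd P ^ m" by (simp add: le_imp_power_dvd)
      then show False using Pm[OF i0(1)] i0(1) dvd_trans by (auto simp: bad_def)
    qed
    define s where "s i = (if i \<in> bad then r i div P ^ m else 0)" for i
    have s: "P ^ m * s i = (if i \<in> bad then r i else 0)" for i
      using Pm by (simp add: s_def)
    \<comment> \<open>The relation divided by P^m: applying P(u)^m to \<open>v'\<close> gives the
      relation back, so \<open>v'\<close> has order at most m.\<close>
    define v' where "v' = (\<Sum>i<k. act (s i) (v i))"
    have van: "act (P ^ n i) (v i) = 0" if "i < k" for i
      using less.prems that by (simp add: gens_def)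
    have "act (P ^ m) v' = (\<Sum>i<k. act (P ^ m * s i) (v i))"
      by (simp add: v'_def act.sum act_mult)
    also have "\<dots> = (\<Sum>i<k. act (r i) (v i))"
    proof (intro sum.cong refl)
      fix i assume i: "i \<in> {..<k}"
      have "act (r i) (v i) = 0" if "i \<notin> bad"
      proof -
        have "P ^ n i dvd r i" using that i by (simp add: bad_def)
        then obtain c where "r i = c * P ^ n i" by (metis dvdE mult.commute)
        then show ?thesis using van i by (simp add: act_mult act.zero)
      qed
      then show "act (P ^ m * s i) (v i) = act (r i) (v i)" by (simp add: s)
    qed
    finally have v'0: "act (P ^ m) v' = 0" using rel by simp
    have "\<not> P dvd s i0"
    proof
      assume "P dvd s i0"
      then have "P ^ m * P dvd P ^ m * s i0" by (rule mult_dvd_mono[OF dvd_refl])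
      then have "P ^ Suc m dvd r i0" using i0(1) s[of i0] by (simp only: if_True power_Suc2)
      then show False using i0(2) by blast
    qed
    \<comment> \<open>By the choice of m, s i0 is a unit modulo P^(n i0). So \<open>v i0\<close> can
      be recovered from \<open>v'\<close> and the other generators, and the exchange keeps the
      family generating.\<close>
    then obtain a b where ab: "a * s i0 + b * P ^ n i0 = 1"
      using irreducible_power_bezout[OF P] by blast
    have v0: "v i0 = act a (act (s i0) (v i0))"
    proof -
      have "v i0 = act (a * s i0 + b * P ^ n i0) (v i0)" by (simp add: ab)
      also have "\<dots> = act a (act (s i0) (v i0))"
        using van[OF i0k] by (simp only: act_add act_mult act.zero add_0_right)
      finally show ?thesis .
    qed
    let ?J = "{..<k} - {i0}"
    have split: "(\<Sum>i<k. f i) = f i0 + (\<Sum>i\<in>?J. f i)" for f :: "nat \<Rightarrow> 'b"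
      using i0k by (intro sum.remove) auto
    let ?v = "v(i0 := v')" and ?n = "n(i0 := m)"
    have "gens P k ?v ?n"
      unfolding gens_def
    proof (intro conjI allI impI)
      fix i assume "i < k"
      then show "act (P ^ ?n i) (?v i) = 0" using v'0 van by simp
    next
      fix x
      obtain c where c: "x = (\<Sum>i<k. act (c i) (v i))" using less.prems by (auto simp: gens_def)
      have e: "act (s i0) (v i0) = v' - (\<Sum>i\<in>?J. act (s i) (v i))"
        unfolding v'_def split by simp
      have "act (c i0) (v i0)
          = act (c i0 * a) v' - (\<Sum>i\<in>?J. act (c i0 * a * s i) (v i))"
        by (subst v0, subst e) (simp add: act_mult act.diff act.sum)
      then have "x = act (c i0 * a) v'
          + (\<Sum>i\<in>?J. act (c i - c i0 * a * s i) (v i))"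
        unfolding c split by (simp add: act_diff sum_subtractf)
      also have "\<dots> = (\<Sum>i<k. act (if i = i0 then c i0 * a else c i - c i0 * a * s i) (?v i))"
        unfolding split by (simp cong: sum.cong_simp)
      finally show "\<exists>r. x = (\<Sum>i<k. act (r i) (?v i))"
        by (rule exI[of _ "\<lambda>i. if i = i0 then c i0 * a else c i - c i0 * a * s i"])
    qed
    moreover have "(\<Sum>i<k. ?n i) < (\<Sum>i<k. n i)"
      by (rule sum_strict_mono_ex1) (use m_less i0k in auto)
    ultimately show ?thesis using less.hyps by blast
  qed
qed

section \<open>Chains of iterates and companion blocks\<close>

definition chain :: "'b \<Rightarrow> nat \<Rightarrow> 'b list" where
  "chain w m = map (\<lambda>j. (u ^^ j) w) [0..<m]"

lemma length_chain [simp]: "length (chain w m) = m"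
  by (simp add: chain_def)

lemma act_monom: "act (monom c j) w = c *s (u ^^ j) w"
  by (simp add: monom_altdef act_smult act_power_u)

lemma act_mod_in_span:
  assumes "Q \<noteq> 0" "act Q w = 0" "\<And>j. j < degree Q \<Longrightarrow> (u ^^ j) w \<in> S"
  shows "act r w \<in> span S"
proof -
  have "act r w = act (r div Q * Q + r mod Q) w" by simp
  also have "\<dots> = act (r mod Q) w" using assms(2) by (simp only: act_add act_mult act.zero add_0)
  also have "\<dots> \<in> span S"
  proof (cases "r mod Q = 0")
    case False
    then have "degree (r mod Q) < degree Q" using degree_mod_less[OF assms(1), of r] by simp
    then show ?thesis
      unfolding poly_endo_def by (intro span_sum span_scale span_base assms(3)) simp
  qed (simp add: span_zero)
  finally show ?thesis .
qed

text \<open>A linear relation between iterates is a module relation whose coefficients have degree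
  below that of P^(n i). Freeness makes P^(n i) divide them, so they vanish. Exponents 0 would give
  empty chains and are filtered out, which leaves positive exponents for the blocks.\<close>

lemma free_gens_basis:
  assumes P: "monic_poly P" and g: "gens P k v n"
    and free: "\<And>r i. (\<Sum>i<k. act (r i) (v i)) = 0 \<Longrightarrow> i < k \<Longrightarrow> P ^ n i dvd r i"
  shows "ordered_basis scale
    (concat (map (\<lambda>i. chain (v i) (degree (P ^ n i))) (filter (\<lambda>i. 0 < n i) [0..<k])))"
proof -
  define d where "d i = degree (P ^ n i)" for i
  define I where "I = Sigma {..<k} (\<lambda>i. {..<d i})"
  define g where "g = (\<lambda>(i, j). (u ^^ j) (v i))"
  define js where "js = filter (\<lambda>i. 0 < n i) [0..<k]"
  define idx where "idx = concat (map (\<lambda>i. map (Pair i) [0..<d i]) js)"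
  have P0: "P ^ m \<noteq> 0" for m using P by (auto simp: monic_poly_def)
  have d0: "d i = 0" if "n i = 0" for i using that by (simp add: d_def)
  have set_idx: "set idx = I"
    using d0 by (fastforce simp: idx_def js_def I_def)
  have "distinct js \<Longrightarrow> distinct (concat (map (\<lambda>i. map (Pair i) [0..<d i]) js))" for js
    by (induction js) (auto simp: distinct_map inj_on_def)
  then have dist: "distinct idx" by (simp add: idx_def js_def)
  have bs: "concat (map (\<lambda>i. chain (v i) (d i)) js) = map g idx"
    by (simp add: idx_def map_concat chain_def g_def o_def)
  have fin: "finite I" by (simp add: I_def)
  have ind: "c p = 0" if c: "(\<Sum>p\<in>I. c p *s g p) = 0" and p: "p \<in> I" for c p
  proof -
    obtain i j where ij: "p = (i, j)" "i < k" "j < d i" using p by (auto simp: I_def)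
    define r where "r i = (\<Sum>j<d i. monom (c (i, j)) j)" for i
    have "(\<Sum>i<k. act (r i) (v i)) = (\<Sum>i<k. \<Sum>j<d i. c (i, j) *s g (i, j))"
      by (simp add: r_def act_sum act_monom g_def)
    also have "\<dots> = (\<Sum>p\<in>I. c p *s g p)"
      unfolding I_def by (subst sum.Sigma) (auto intro!: sum.cong)
    finally have "P ^ n i dvd r i" using c free ij(2) by simp
    moreover have "degree (r i) < d i"
    proof -
      have "degree (r i) \<le> d i - 1"
        unfolding r_def by (rule degree_sum_le) (auto intro: order.trans[OF degree_monom_le])
      then show ?thesis using ij(3) by simp
    qed
    ultimately have "r i = 0" using P0 d_def dvd_imp_degree_le by (metis not_le)
    then have "coeff (r i) j = 0" by simp
    moreover have "coeff (r i) j = c (i, j)"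
      using ij(3) by (simp add: r_def coeff_sum)
    ultimately show ?thesis using ij(1) by simp
  qed
  have inj: "inj_on g I" by (rule family_independentI(1)[OF fin]) (rule ind)
  have indep: "independent (g ` I)" by (rule family_independentI(2)[OF fin]) (rule ind)
  have "x \<in> span (g ` I)" for x
  proof -
    obtain r where r: "x = (\<Sum>i<k. act (r i) (v i))" using g by (auto simp: gens_def)
    have "act (r i) (v i) \<in> span (g ` I)" if "i < k" for i
    proof (rule act_mod_in_span[OF P0, of "n i"])
      show "act (P ^ n i) (v i) = 0" using assms(2) that by (simp add: gens_def)
      fix j assume "j < degree (P ^ n i)"
      then show "(u ^^ j) (v i) \<in> g ` I"
        using that by (intro image_eqI[of _ _ "(i, j)"]) (auto simp: g_def I_def d_def)
    qed
    then show ?thesis unfolding r by (intro span_sum) simp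
  qed
  then have "ordered_basis scale (map g idx)"
    using inj indep dist set_idx by (auto simp: ordered_basis_def distinct_map)
  then show ?thesis by (simp add: bs[symmetric] js_def d_def)
qed

lemma represents_append:
  assumes A: "A \<in> carrier_mat (length xs) (length xs)" and B: "B \<in> carrier_mat (length ys) (length ys)"
  shows "represents (xs @ ys)
      (four_block_mat A (0\<^sub>m (length xs) (length ys)) (0\<^sub>m (length ys) (length xs)) B)
    \<longleftrightarrow> represents xs A \<and> represents ys B"
proof -
  let ?M = "four_block_mat A (0\<^sub>m (length xs) (length ys)) (0\<^sub>m (length ys) (length xs)) B"
  have M: "?M \<in> carrier_mat (length (xs @ ys)) (length (xs @ ys))" using A B by auto
  have 1: "(\<Sum>i<length (xs @ ys). ?M $$ (i, j) *s (xs @ ys) ! i) = (\<Sum>i<length xs. A $$ (i, j) *s xs ! i)"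
    if "j < length xs" for j
    using that A B by (simp add: sum_lessThan_append nth_append)
  have 2: "(\<Sum>i<length (xs @ ys). ?M $$ (i, length xs + j) *s (xs @ ys) ! i)
      = (\<Sum>i<length ys. B $$ (i, j) *s ys ! i)"
    if "j < length ys" for j
    using that A B by (simp add: sum_lessThan_append nth_append)
  have "represents (xs @ ys) ?M \<longleftrightarrow>
      (\<forall>j<length xs. u ((xs @ ys) ! j) = (\<Sum>i<length (xs @ ys). ?M $$ (i, j) *s (xs @ ys) ! i)) \<and>
      (\<forall>j<length ys. u ((xs @ ys) ! (length xs + j))
        = (\<Sum>i<length (xs @ ys). ?M $$ (i, length xs + j) *s (xs @ ys) ! i))"
    using M unfolding represents_def length_append by (simp only: all_less_add_iff simp_thms)
  also have "\<dots> \<longleftrightarrow> represents xs A \<and> represents ys B"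
    unfolding represents_def using A B 1 2 by (simp add: nth_append)
  finally show ?thesis .
qed

text \<open>Each column before the last says that u sends a vector of the list to the next one; the
  last column is then the equation r(u) w = 0.\<close>

lemma represents_companion:
  assumes r: "monic_poly r" "degree r > 0"
  shows "represents bs (companion_mat r) \<longleftrightarrow> (\<exists>w. bs = chain w (degree r) \<and> act r w = 0)"
proof -
  define m where "m = degree r"
  have m: "m > 0" using r by (simp add: m_def)
  have C: "companion_mat r \<in> carrier_mat m m" by (simp add: companion_mat_def m_def)
  have step: "(\<Sum>i<m. companion_mat r $$ (i, j) *s bs ! i) = bs ! Suc j" if "Suc j < m" for j bs
  proof -
    have "(\<Sum>i<m. companion_mat r $$ (i, j) *s bs ! i) = (\<Sum>i<m. if i = Suc j then bs ! i else 0)"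
      using that by (intro sum.cong) (auto simp: companion_mat_def m_def)
    then show ?thesis using that by simp
  qed
  have last: "(\<Sum>i<m. companion_mat r $$ (i, m - 1) *s bs ! i) = - (\<Sum>i<m. coeff r i *s bs ! i)" for bs
    using m by (auto simp: companion_mat_def m_def sum_negf[symmetric] intro!: sum.cong)
  have act_r: "act r w = (\<Sum>i<m. coeff r i *s (u ^^ i) w) + (u ^^ m) w" for w
    using r(1) by (simp add: poly_endo_def m_def monic_poly_def lessThan_Suc_atMost[symmetric])
  show ?thesis
  proof
    assume "represents bs (companion_mat r)"
    then have len: "length bs = m"
      and rep: "\<And>j. j < m \<Longrightarrow> u (bs ! j) = (\<Sum>i<m. companion_mat r $$ (i, j) *s bs ! i)"
      using C by (auto simp: represents_def)
    define w where "w = bs ! 0"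
    have nth: "bs ! j = (u ^^ j) w" if "j < m" for j
      using that
    proof (induction j)
      case (Suc j)
      then have "u (bs ! j) = bs ! Suc j" using rep[of j] step[of j bs] by simp
      then show ?case using Suc by simp
    qed (simp add: w_def)
    have bs: "bs = chain w m" by (rule nth_equalityI) (auto simp: len nth chain_def)
    have "(u ^^ m) w = u (bs ! (m - 1))" using m nth[of "m - 1"] by (cases m) simp_all
    also have "\<dots> = - (\<Sum>i<m. coeff r i *s bs ! i)" using rep[of "m - 1"] m last by simp
    also have "(\<Sum>i<m. coeff r i *s bs ! i) = (\<Sum>i<m. coeff r i *s (u ^^ i) w)"
      by (simp add: nth)
    finally have "act r w = 0" by (simp add: act_r)
    then show "\<exists>w. bs = chain w (degree r) \<and> act r w = 0" using bs by (auto simp: m_def)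
  next
    assume "\<exists>w. bs = chain w (degree r) \<and> act r w = 0"
    then obtain w where bs: "bs = chain w m" and w: "act r w = 0" by (auto simp: m_def)
    have nth: "bs ! j = (u ^^ j) w" if "j < m" for j using that by (simp add: bs chain_def)
    have "u (bs ! j) = (\<Sum>i<m. companion_mat r $$ (i, j) *s bs ! i)" if j: "j < m" for j
    proof (cases "Suc j < m")
      case True
      then have "u (bs ! j) = bs ! Suc j" by (simp add: nth)
      then show ?thesis by (simp only: step[OF True])
    next
      case False
      then have j': "m = Suc j" using j by auto
      have "u (bs ! j) = (u ^^ m) w" using nth[OF j] j' by simp
      also have "\<dots> = - (\<Sum>i<m. coeff r i *s (u ^^ i) w)"
        using w by (simp add: act_r eq_neg_iff_add_eq_0 add.commute)
      also have "\<dots> = (\<Sum>i<m. companion_mat r $$ (i, j) *s bs ! i)"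
        using last[of bs] by (simp add: nth j')
      finally show ?thesis .
    qed
    then show "represents bs (companion_mat r)" using C bs by (simp add: represents_def)
  qed
qed

text \<open>Read from left to right it extracts cyclic generators from the matrix in (iii); from
  right to left it produces that matrix. It holds for arbitrary lists because the induction passes
  to the tail of a basis.\<close>

lemma represents_diag_block_companion:
  assumes P: "monic_poly P" "degree P > 0" and "\<forall>n\<in>set ns. 0 < n"
  shows "represents bs (diag_block_mat (map (\<lambda>n. companion_mat (P ^ n)) ns)) \<longleftrightarrow>
    (\<exists>wns. map snd wns = ns \<and> bs = concat (map (\<lambda>(w, n). chain w (degree (P ^ n))) wns) \<and>
      (\<forall>(w, n)\<in>set wns. act (P ^ n) w = 0))"
  using assms(3)
proof (induction ns arbitrary: bs)
  case Nil
  then show ?case by (auto simp: represents_def)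
next
  case (Cons n ns)
  define m where "m = degree (P ^ n)"
  have "P \<noteq> 0" using P(2) by auto
  then have Pn: "monic_poly (P ^ n)" "degree (P ^ n) > 0"
    using P Cons.prems monic_poly_power[OF P(1)] by (auto simp: degree_power_eq)
  define A where "A = companion_mat (P ^ n)"
  define B where "B = diag_block_mat (map (\<lambda>n. companion_mat (P ^ n)) ns)"
  have A: "A \<in> carrier_mat m m" by (simp add: A_def companion_mat_def m_def)
  have IH: "represents ys B \<longleftrightarrow>
    (\<exists>wns. map snd wns = ns \<and> ys = concat (map (\<lambda>(w, n). chain w (degree (P ^ n))) wns) \<and>
      (\<forall>(w, n)\<in>set wns. act (P ^ n) w = 0))" for ys
    using Cons unfolding B_def by auto
  have D: "diag_block_mat (map (\<lambda>n. companion_mat (P ^ n)) (n # ns))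
    = four_block_mat A (0\<^sub>m m (dim_col B)) (0\<^sub>m (dim_row B) m) B"
    using A by (simp add: Let_def A_def B_def)
  show ?case
  proof
    assume "represents bs (diag_block_mat (map (\<lambda>n. companion_mat (P ^ n)) (n # ns)))"
    then have rep: "represents bs (four_block_mat A (0\<^sub>m m (dim_col B)) (0\<^sub>m (dim_row B) m) B)"
      by (simp only: D)
    \<comment> \<open>That \<open>B\<close> is square is read off here: both of its dimensions are
      the length of \<open>bs\<close> minus m.\<close>
    then have len: "length bs = m + dim_row B" "length bs = m + dim_col B"
      using A by (auto simp: represents_def)
    define xs ys where "xs = take m bs" and "ys = drop m bs"
    have bs: "bs = xs @ ys" by (simp add: xs_def ys_def)
    have lens: "length xs = m" "length ys = dim_row B" "length ys = dim_col B"
      using len by (auto simp: xs_def ys_def)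
    have B: "B \<in> carrier_mat (length ys) (length ys)" using lens by auto
    have "represents xs A" "represents ys B"
      using represents_append[of A xs B ys] A B rep[unfolded bs] unfolding lens(1)[symmetric]
      by (simp_all only: lens(2)[symmetric] lens(3)[symmetric])
    then obtain w wns where "xs = chain w m" "act (P ^ n) w = 0" "map snd wns = ns"
      "ys = concat (map (\<lambda>(w, n). chain w (degree (P ^ n))) wns)"
      "\<forall>(w, n)\<in>set wns. act (P ^ n) w = 0"
      using represents_companion[OF Pn] IH by (auto simp: m_def A_def)
    then show "\<exists>wns. map snd wns = n # ns \<and> bs = concat (map (\<lambda>(w, n). chain w (degree (P ^ n))) wns) \<and>
      (\<forall>(w, n)\<in>set wns. act (P ^ n) w = 0)"
      by (intro exI[of _ "(w, n) # wns"]) (auto simp: bs m_def)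
  next
    assume "\<exists>wns. map snd wns = n # ns \<and> bs = concat (map (\<lambda>(w, n). chain w (degree (P ^ n))) wns) \<and>
      (\<forall>(w, n)\<in>set wns. act (P ^ n) w = 0)"
    then obtain w wns where w: "map snd wns = ns" "act (P ^ n) w = 0"
      "\<forall>(w, n)\<in>set wns. act (P ^ n) w = 0"
      "bs = chain w m @ concat (map (\<lambda>(w, n). chain w (degree (P ^ n))) wns)"
      by (auto simp: m_def)
    define ys where "ys = concat (map (\<lambda>(w, n). chain w (degree (P ^ n))) wns)"
    have ys: "represents ys B" using IH w ys_def by blast
    then have B: "B \<in> carrier_mat (length ys) (length ys)" by (simp add: represents_def)
    have "represents (chain w m) A" using represents_companion[OF Pn] w by (auto simp: m_def A_def)
    then have "represents (chain w m @ ys) (four_block_mat A (0\<^sub>m m (length ys)) (0\<^sub>m (length ys) m) B)"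
      using represents_append[of A "chain w m" B ys] A B ys by simp
    then show "represents bs (diag_block_mat (map (\<lambda>n. companion_mat (P ^ n)) (n # ns)))"
      using B unfolding D w(4) ys_def[symmetric] by auto
  qed
qed

lemma block_companion_of_power:
  assumes P: "irreducible P" "monic_poly P" "degree P > 0" and "annihilates scale (P ^ N) u"
  shows "\<exists>bs ns. ordered_basis scale bs \<and> (\<forall>n\<in>set ns. 0 < n) \<and>
    matrix_in scale bs u = diag_block_mat (map (\<lambda>n. companion_mat (P ^ n)) ns)"
proof -
  obtain k v where "gens P k v (\<lambda>_. N)" using gens_exist assms by blast
  then obtain v n where g: "gens P k v n"
    and free: "\<And>r i. (\<Sum>i<k. act (r i) (v i)) = 0 \<Longrightarrow> i < k \<Longrightarrow> P ^ n i dvd r i"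
    using gens_free[OF P(1)] by meson
  define js where "js = filter (\<lambda>i. 0 < n i) [0..<k]"
  define bs where "bs = concat (map (\<lambda>i. chain (v i) (degree (P ^ n i))) js)"
  have bs: "ordered_basis scale bs" unfolding bs_def js_def by (rule free_gens_basis[OF P(2) g]) (rule free)
  let ?wns = "map (\<lambda>i. (v i, n i)) js"
  have pos: "\<forall>n\<in>set (map snd ?wns). 0 < n" by (auto simp: js_def)
  have "bs = concat (map (\<lambda>(w, n). chain w (degree (P ^ n))) ?wns)"
    by (simp add: bs_def o_def)
  moreover have "\<forall>(w, n)\<in>set ?wns. act (P ^ n) w = 0" using g by (auto simp: gens_def js_def)
  ultimately have "represents bs (diag_block_mat (map (\<lambda>n. companion_mat (P ^ n)) (map snd ?wns)))"
    using represents_diag_block_companion[OF P(2,3) pos] by blast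
  then show ?thesis using matrix_in_eq_iff[OF bs] bs pos by blast
qed

section \<open>Quotients\<close>

lemma annihilates_of_chains:
  assumes bs: "ordered_basis scale (concat (map (\<lambda>(w, n). chain w (d n)) wns))"
    and ann: "\<forall>(w, n)\<in>set wns. act (P ^ n) w = 0"
  shows "\<exists>N. annihilates scale (P ^ N) u"
proof -
  \<comment> \<open>Any common upper bound of the exponents would do; the sum is one, also for the
    empty list.\<close>
  define N where "N = sum_list (map snd wns)"
  have "annihilates scale (P ^ N) u"
  proof (rule annihilates_if_spanning[OF ordered_basisD(3)[OF bs]])
    fix v assume "v \<in> set (concat (map (\<lambda>(w, n). chain w (d n)) wns))"
    then obtain w n j where wn: "(w, n) \<in> set wns" and v: "v = (u ^^ j) w"
      by (auto simp: chain_def)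
    have "n \<in> set (map snd wns)" using wn by force
    then have "n \<le> N" unfolding N_def by (intro member_le_sum_list) simp_all
    then have "P ^ N = P ^ (N - n) * P ^ n" by (simp flip: power_add)
    then have e: "P ^ N * [:0, 1:] ^ j = [:0, 1:] ^ j * P ^ (N - n) * P ^ n"
      by (simp only: mult_ac)
    have "act (P ^ N) v = act ([:0, 1:] ^ j * P ^ (N - n)) (act (P ^ n) w)"
      unfolding v act_power_u[symmetric] act_mult[symmetric] by (simp only: e)
    then show "act (P ^ N) v = 0" using ann wn by (auto simp: act.zero)
  qed
  then show ?thesis by blast
qed

text \<open>An irreducible P of degree above 1 does not divide t, so t is a unit modulo P^N. The
  inverse of u is thus a polynomial in u, which commutes with P(u).\<close>

lemma u_inverse_poly:
  assumes "irreducible P" "degree P > 1" "annihilates scale (P ^ N) u"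
  obtains h where "\<And>v. act ([:0, 1:] * h) v = v"
proof -
  have "\<not> P dvd [:0, 1:]" using assms(2) dvd_imp_degree_le[of P "[:0, 1:]"] by auto
  then obtain a b where "a * [:0, 1:] + b * P ^ N = 1"
    using irreducible_power_bezout[OF assms(1)] by blast
  then have "[:0, 1:] * a = 1 - b * P ^ N" by (metis add_diff_cancel_right' mult.commute)
  then have "act ([:0, 1:] * a) v = v" for v
    using assms(3) by (simp only: act_diff act_mult act.zero act_1 annihilates_def) simp
  then show thesis by (rule that)
qed

text \<open>In the chain basis attached to \<open>P(t)/t\<close>, namely \<open>e\<^sub>j = (P(u) u\<^sup>-\<^sup>1)\<^sup>j w\<close> and \<open>f\<^sub>j = u e\<^sub>j\<close>, put
  \<open>b e\<^sub>j = y s\<^sup>j e\<^sub>j\<close>, \<open>b f\<^sub>j = y s\<^sup>j (f\<^sub>j - e\<^sub>j\<^sub>+\<^sub>1)\<close> and \<open>a = u b\<close>. When \<open>s = -1\<close> and \<open>\<tau> = 0\<close>, the map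
  \<open>y\<^sup>-\<^sup>1 b\<close> is the ring involution \<open>t \<mapsto> -\<delta>/t\<close> of \<open>F[t]/(P\<^sup>n)\<close>.\<close>
lemma pq_quotient_of_chains:
  assumes P: "P = [:\<delta>, - \<tau>, 1:]" "irreducible P"
    and bs: "ordered_basis scale (concat (map (\<lambda>(w, n). chain w (degree (P ^ n))) wns))"
    and pos: "\<forall>n\<in>set (map snd wns). 0 < n"
    and ann: "\<forall>(w, n)\<in>set wns. act (P ^ n) w = 0"
    and nz: "y \<noteq> 0" "\<delta> \<noteq> 0"
    and s: "s = 1 \<or> (s = - 1 \<and> \<tau> = 0)"
  shows "pq_quotient scale [:y\<^sup>2 * \<delta>, - (y * \<tau>), 1:] [:y\<^sup>2 * s, - (y * (1 + s)), 1:] u"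
proof -
  let ?bs = "concat (map (\<lambda>(w, n). chain w (degree (P ^ n))) wns)"
  have degP: "degree P = 2" by (simp add: P)
  have P0: "P \<noteq> 0" using degP by auto
  obtain N where N: "annihilates scale (P ^ N) u" using annihilates_of_chains[OF bs ann] by blast
  obtain h where h: "\<And>v. act ([:0, 1:] * h) v = v"
    using u_inverse_poly[OF P(2) _ N] degP by auto
  have actP: "act P v = \<delta> *s v - \<tau> *s u v + u (u v)" for v
    by (simp add: P act_pCons u.add u.diff u.neg u.scale u.zero)
  define K where "K = length wns"
  define n where "n k = snd (wns ! k)" for k
  define e where "e k j = act ((P * h) ^ j) (fst (wns ! k))" for k j
  define f where "f k j = u (e k j)" for k j
  have e_Suc: "e k (Suc j) = act (P * h) (e k j)" for k j
    by (simp only: e_def act_mult power_Suc)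
  \<comment> \<open>Chains stop at n k. The recursions below therefore stay valid at the last index
    j = n k - 1, where the vectors with index \<open>Suc j\<close> are zero.\<close>
  have e_n: "e k (n k) = 0" if "k < K" for k
  proof -
    have "wns ! k \<in> set wns" using that by (simp add: K_def)
    then have "act (P ^ n k) (fst (wns ! k)) = 0" using ann by (auto simp: n_def split: prod.splits)
    then show ?thesis
      by (simp add: e_def power_mult_distrib mult.commute[of "P ^ _"] act_mult act.zero)
  qed
  \<comment> \<open>Multiplying P h by t cancels h, so f_(j+1) = P(u) e_j. Solved for u f_j this is
    the companion action of P on <e_j, f_j> plus f_(j+1).\<close>
  have f_Suc: "f k (Suc j) = \<delta> *s e k j - \<tau> *s f k j + u (f k j)" for k j
  proof -
    have "f k (Suc j) = act ([:0, 1:] * (P * h)) (e k j)"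
      by (simp only: f_def e_Suc act_mult act_X)
    also have "[:0, 1:] * (P * h) = P * ([:0, 1:] * h)" by (simp only: mult.left_commute)
    also have "act \<dots> (e k j) = act P (e k j)" by (simp only: act_mult[of P] h)
    finally show ?thesis by (simp only: actP f_def)
  qed
  define I where "I = Sigma {..<K} (\<lambda>k. {..<n k}) \<times> (UNIV :: bool set)"
  define G where "G = (\<lambda>((k, j), c). if c then f k j else e k j)"
  have fin: "finite I" by (simp add: I_def)
  have G_span: "e k j \<in> span (G ` I)" "f k j \<in> span (G ` I)" if "k < K" "j \<le> n k" for k j
  proof -
    have "e k j \<in> span (G ` I) \<and> f k j \<in> span (G ` I)"
    proof (cases "j = n k")
      case True
      then show ?thesis using e_n that by (simp add: f_def u.zero span_zero)
    next
      case False
      then have "((k, j), c) \<in> I" for c using that by (simp add: I_def)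
      then have "G ((k, j), c) \<in> span (G ` I)" for c by (intro span_base) blast
      from this[of False] this[of True] show ?thesis by (simp add: G_def)
    qed
    then show "e k j \<in> span (G ` I)" "f k j \<in> span (G ` I)" by auto
  qed
  have u_f: "u (f k j) = \<tau> *s f k j - \<delta> *s e k j + f k (Suc j)" for k j
    by (simp add: f_Suc)
  have u_span: "u x \<in> span (G ` I)" if "x \<in> span (G ` I)" for x
    using that
  proof (induction rule: span_induct_alt)
    case base
    then show ?case by (simp add: u.zero span_zero)
  next
    case (step c x z)
    obtain k j d where kj: "x = G ((k, j), d)" "k < K" "j < n k" using step(1) by (auto simp: I_def)
    have "u (e k j) \<in> span (G ` I)" using G_span(2)[of k j] kj by (simp add: f_def)
    moreover have "u (f k j) \<in> span (G ` I)"
      unfolding u_f using G_span[of k j] G_span(2)[of k "Suc j"] kj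
      by (intro span_add span_diff span_scale) auto
    ultimately have "u x \<in> span (G ` I)" unfolding kj(1) by (simp add: G_def)
    then show ?case using step by (simp add: u.add u.scale span_add span_scale)
  qed
  \<comment> \<open>The span of the new family is stable under u and contains every generator w =
    e_0, hence all chains.\<close>
  have "set ?bs \<subseteq> span (G ` I)"
  proof
    fix v assume "v \<in> set ?bs"
    then obtain w m j where wm: "(w, m) \<in> set wns" and v: "v = (u ^^ j) w"
      by (auto simp: chain_def)
    then obtain k where k: "k < K" "wns ! k = (w, m)" by (auto simp: in_set_conv_nth K_def)
    have "e k 0 = w" using k by (simp add: e_def)
    then have "w \<in> span (G ` I)" using G_span(1)[of k 0] k by simp
    then have "(u ^^ j) w \<in> span (G ` I)" by (induction j) (auto intro: u_span)
    then show "v \<in> span (G ` I)" by (simp add: v)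
  qed
  then have span: "span (G ` I) = UNIV"
    using span_minimal[OF _ subspace_span, of "set ?bs" "G ` I"] ordered_basisD(3)[OF bs] by auto
  \<comment> \<open>Independence comes from counting: P has degree 2, so the spanning family has
    exactly as many members as the old basis.\<close>
  have "card I = (\<Sum>k<K. n k * 2)"
    by (simp add: I_def card_cartesian_product sum_distrib_right)
  also have "\<dots> = length ?bs"
    by (simp add: length_concat sum_list_sum_nth K_def n_def degree_power_eq[OF P0] degP
        lessThan_atLeast0 split_def mult.commute)
  also have "\<dots> = card (set ?bs)" using distinct_card[OF ordered_basisD(1)[OF bs]] by simp
  also have "\<dots> = dim UNIV"
    using dim_eq_card[of "set ?bs" UNIV] ordered_basisD[OF bs] by simp
  finally have cardI: "card I = dim UNIV" .
  have "dim UNIV \<le> card (G ` I)" using span fin by (intro dim_le_card) auto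
  then have "card (G ` I) = card I" using card_image_le[OF fin, of G] cardI by simp
  then have inj: "inj_on G I" and indep: "independent (G ` I)"
    using eq_card_imp_inj_on[OF fin] card_le_dim_spanning[of "G ` I" UNIV] span fin cardI by auto
  interpret pair: vector_space_pair scale scale by unfold_locales
  \<comment> \<open>The prescribed values of b on the basis. The term - e_(j+1) cancels f_(j+1) in u
    f_j, which makes the planes <e_j, f_j> stable under u b.\<close>
  define H where "H = (\<lambda>((k, j), c). (y * s ^ j) *s (if c then f k j - e k (Suc j) else e k j))"
  obtain b where linear_b: "Vector_Spaces.linear scale scale b"
    and b: "\<And>x. x \<in> G ` I \<Longrightarrow> b x = H (inv_into I G x)"
    using pair.linear_independent_extend[OF indep, of "\<lambda>x. H (inv_into I G x)"] by blast
  interpret b: fd_endo scale Basis b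
    by (intro fd_endo.intro fd_endo_axioms.intro finite_dimensional_vector_space_axioms linear_b)
  have b_G: "b (G i) = H i" if "i \<in> I" for i using b that inj by simp
  \<comment> \<open>The case j = n k is included because b f_j involves e_(j+1), to which b is
    applied once more.\<close>
  have b_e: "b (e k j) = (y * s ^ j) *s e k j" if "k < K" "j \<le> n k" for k j
  proof (cases "j = n k")
    case True
    then show ?thesis using e_n that by (simp add: b.u.zero)
  next
    case False
    then show ?thesis using b_G[of "((k, j), False)"] that by (simp add: I_def G_def H_def)
  qed
  have b_f: "b (f k j) = (y * s ^ j) *s (f k j - e k (Suc j))" if "k < K" "j < n k" for k j
    using b_G[of "((k, j), True)"] that by (simp add: I_def G_def H_def)
  define a where "a = u \<circ> b"
  have linear_a: "Vector_Spaces.linear scale scale a"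
    unfolding a_def by (rule Vector_Spaces.linear_compose[OF linear_b linear_u])
  interpret a: fd_endo scale Basis a
    by (intro fd_endo.intro fd_endo_axioms.intro finite_dimensional_vector_space_axioms linear_a)
  have a_e: "a (e k j) = (y * s ^ j) *s f k j" if "k < K" "j < n k" for k j
    using that by (simp add: a_def b_e u.scale f_def)
  have a_f: "a (f k j) = (y * s ^ j) *s (\<tau> *s f k j - \<delta> *s e k j)" if "k < K" "j < n k" for k j
  proof -
    have "u (f k j - e k (Suc j)) = \<tau> *s f k j - \<delta> *s e k j"
      by (simp add: u.diff u_f f_def[symmetric])
    then show ?thesis using that by (simp add: a_def b_f u.scale)
  qed
  \<comment> \<open>These identities remove j from the quadratic relations. For s = -1 the last two
    hold because \<tau> and 1 + s are zero.\<close>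
  have sq: "s ^ j * s ^ j = 1" "\<tau> * s ^ j = \<tau>" "(1 + s) * s ^ j = 1 + s" for j
    using s by (auto simp: power_mult_distrib[symmetric])
  have sq': "s ^ j * (s ^ j * x) = x" "\<tau> * (s ^ j * x) = \<tau> * x" for j x
    using sq[of j] by (metis mult.assoc mult_1)+
  have I_cases: "\<exists>k j. k < K \<and> j < n k \<and> (x = e k j \<or> x = f k j)" if "x \<in> G ` I" for x
  proof -
    obtain k j c where "x = G ((k, j), c)" "k < K" "j < n k" using \<open>x \<in> G ` I\<close> by (auto simp: I_def)
    then show ?thesis by (intro exI[of _ k] exI[of _ j]) (auto simp: G_def)
  qed
  let ?p = "[:y\<^sup>2 * \<delta>, - (y * \<tau>), 1:]" and ?q = "[:y\<^sup>2 * s, - (y * (1 + s)), 1:]"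
  have act_a: "a.act ?p v = (y\<^sup>2 * \<delta>) *s v - (y * \<tau>) *s a v + a (a v)" for v
    by (simp add: a.act_pCons a.u.add a.u.diff a.u.neg a.u.scale a.u.zero)
  have act_b: "b.act ?q v = (y\<^sup>2 * s) *s v - (y * (1 + s)) *s b v + b (b v)" for v
    by (simp add: b.act_pCons b.u.add b.u.diff b.u.neg b.u.scale b.u.zero)
  have "annihilates scale ?p a"
  proof (rule a.annihilates_if_spanning[OF span])
    fix x assume "x \<in> G ` I"
    then obtain k j where kj: "k < K" "j < n k" and x: "x = e k j \<or> x = f k j" using I_cases by blast
    note ae = a_e[OF kj] and af = a_f[OF kj]
    have "y * s ^ j * (y * s ^ j) = y\<^sup>2"
      using sq(1)[of j] by (simp add: power2_eq_square ac_simps sq')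
    then have yy: "(y * s ^ j) *s (y * s ^ j) *s v = y\<^sup>2 *s v" for v by simp
    have "y * \<tau> * (y * s ^ j) = y\<^sup>2 * (\<tau> * s ^ j)"
      by (simp add: power2_eq_square ac_simps)
    also have "\<dots> = y\<^sup>2 * \<tau>" by (simp only: sq)
    finally have yt: "(y * \<tau>) *s (y * s ^ j) *s v = (y\<^sup>2 * \<tau>) *s v" for v by simp
    have aae: "a (a (e k j)) = y\<^sup>2 *s (\<tau> *s f k j - \<delta> *s e k j)"
      unfolding ae a.u.scale af by (rule yy)
    have e0: "a.act ?p (e k j) = 0"
      unfolding act_a aae unfolding ae yt by (simp add: scale_right_diff_distrib)
    \<comment> \<open>Since f_j is a multiple of a e_j and p(a) commutes with a, the relation at f_j
      follows from the one at e_j.\<close>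
    have "y * s ^ j \<noteq> 0" using nz(1) s by auto
    moreover have "(inverse c * c) *s v = v" if "c \<noteq> 0" for c v using that by simp
    ultimately have "a (inverse (y * s ^ j) *s e k j) = f k j"
      unfolding a.u.scale ae scale_scale by blast
    then have "a.act ?p (f k j) = a.act ?p (a (inverse (y * s ^ j) *s e k j))" by (simp only:)
    also have "\<dots> = a (a.act ?p ((inverse (y * s ^ j)) *s e k j))"
      unfolding act_a by (simp add: a.u.add a.u.diff a.u.scale)
    also have "\<dots> = 0" by (simp add: a.act.scale e0 a.u.zero del: a.act_pCons)
    finally show "a.act ?p x = 0" using e0 x by auto
  qed
  moreover have "annihilates scale ?q b"
  proof (rule b.annihilates_if_spanning[OF span])
    fix x assume "x \<in> G ` I"
    then obtain k j where kj: "k < K" "j < n k" and x: "x = e k j \<or> x = f k j" using I_cases by blast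
    \<comment> \<open>On e_(j+1) and f_j the map b is triangular with diagonal entries y s^(j+1) and
      y s^j. Their sum y (1 + s) and product y^2 s are those of the roots of q.\<close>
    define e' where "e' = e k (Suc j)"
    have be: "b (e k j) = (y * s ^ j) *s e k j" and be': "b e' = (y * s ^ j * s) *s e'"
      using b_e[of k j] b_e[of k "Suc j"] kj by (simp_all add: e'_def ac_simps)
    have bf: "b (f k j) = (y * s ^ j) *s (f k j - e')" using b_f[OF kj] by (simp add: e'_def)
    have yy: "y * s ^ j * (y * s ^ j) = y\<^sup>2"
      using sq(1)[of j] by (simp add: power2_eq_square ac_simps sq')
    have ys: "y * (1 + s) * (y * s ^ j) = y\<^sup>2 * (1 + s)"
    proof -
      have "y * (1 + s) * (y * s ^ j) = y\<^sup>2 * ((1 + s) * s ^ j)"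
        by (simp add: power2_eq_square ac_simps)
      then show ?thesis by (simp only: sq)
    qed
    have "b.act ?q (e k j) = (y\<^sup>2 * s) *s e k j - (y\<^sup>2 * (1 + s)) *s e k j + y\<^sup>2 *s e k j"
      unfolding act_b be b.u.scale scale_scale yy ys ..
    also have "\<dots> = 0" by (simp add: distrib_left scale_left_distrib)
    finally have e0: "b.act ?q (e k j) = 0" .
    have bbf: "b (b (f k j)) = y\<^sup>2 *s (f k j - e') - (y\<^sup>2 * s) *s e'"
    proof -
      have "b (b (f k j)) = (y * s ^ j) *s ((y * s ^ j) *s (f k j - e') - (y * s ^ j * s) *s e')"
        by (simp only: bf b.u.scale b.u.diff be')
      also have "\<dots> = (y * s ^ j * (y * s ^ j)) *s (f k j - e') - ((y * s ^ j * (y * s ^ j)) * s) *s e'"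
        by (simp only: scale_right_diff_distrib[of _ "(y * s ^ j) *s (f k j - e')"] scale_scale mult.assoc)
      finally show ?thesis by (simp only: yy)
    qed
    have "b.act ?q (f k j) = (y\<^sup>2 * s) *s f k j - (y\<^sup>2 * (1 + s)) *s (f k j - e')
        + (y\<^sup>2 *s (f k j - e') - (y\<^sup>2 * s) *s e')"
      unfolding act_b bbf unfolding bf scale_scale ys ..
    also have "\<dots> = 0" by (simp add: distrib_left scale_left_distrib scale_right_diff_distrib)
    finally show "b.act ?q x = 0" using e0 x by auto
  qed
  moreover have "bij a" using a.bij_if_annihilated[OF \<open>annihilates scale ?p a\<close>] nz by simp
  moreover have "s \<noteq> 0" using s by auto
  then have "bij b" using b.bij_if_annihilated[OF \<open>annihilates scale ?q b\<close>] nz by simp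
  moreover have "u = a \<circ> inv_into UNIV b"
    using bij_is_surj[OF \<open>bij b\<close>] by (auto simp: a_def fun_eq_iff surj_f_inv_f)
  ultimately show ?thesis
    unfolding pq_quotient_def automorphism_def endomorphism_def
    using a.linear_u b.linear_u by blast
qed

end

section \<open>Quadratic polynomials, rescaling and ratios of roots\<close>

lemma H_poly_quadratic:
  assumes "p = [:p0, p1, 1:]" "y \<noteq> 0"
  shows "H_poly y p = [:p0 / y\<^sup>2, p1 / y, 1:]"
  using assms(2)
  by (simp add: H_poly_def assms(1) pcompose_pCons divide_simps power2_eq_square)

text \<open>Substituting y t for t is a degree-preserving ring automorphism with inverse t -> t / y,
  so a factorization of H_y(p) pulls back to one of p.\<close>

lemma irreducible_H_poly:
  fixes p :: "'a::field poly"
  assumes "irreducible p" "y \<noteq> 0"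
  shows "irreducible (H_poly y p)"
proof -
  let ?c = "\<lambda>z r. pcompose r [:0, z:]"
  have inv: "?c (1 / y) (?c y r) = r" for r :: "'a poly"
    using assms(2) by (simp add: pcompose_pCons pcompose_idR flip: pcompose_assoc)
  have p: "p = smult (y\<^sup>2) (?c (1 / y) (H_poly y p))"
    using assms(2) by (simp add: H_poly_def pcompose_smult inv)
  have p0: "p \<noteq> 0" "\<not> p dvd 1" using assms(1) unfolding irreducible_def by blast+
  have H0: "H_poly y p \<noteq> 0" using p p0 by auto
  have deg: "degree (?c (1 / y) r) = degree r" for r :: "'a poly"
    using assms(2) by (simp add: degree_pcompose)
  have unit: "r dvd 1 \<longleftrightarrow> degree r = 0" if "r \<noteq> 0" for r :: "'a poly"
    using that by (simp add: is_unit_iff_degree)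
  have degH: "degree (H_poly y p) = degree p"
    using assms(2) by (simp add: H_poly_def degree_pcompose)
  show ?thesis
  proof (rule irreducibleI)
    show "\<not> H_poly y p dvd 1" using p0 H0 unit degH by simp
  next
    fix A B assume AB: "H_poly y p = A * B"
    then have "A \<noteq> 0" "B \<noteq> 0" using H0 by auto
    have "p = smult (y\<^sup>2) (?c (1 / y) A) * ?c (1 / y) B"
      by (subst p) (simp add: AB pcompose_mult)
    then have "smult (y\<^sup>2) (?c (1 / y) A) dvd 1 \<or> ?c (1 / y) B dvd 1"
      using assms(1) irreducibleD by blast
    moreover have "?c (1 / y) A \<noteq> 0" "?c (1 / y) B \<noteq> 0"
      using \<open>p = _ * _\<close> p0 by auto
    ultimately have "degree A = 0 \<or> degree B = 0"
      using assms(2) by (simp add: is_unit_iff_degree deg)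
    then show "A dvd 1 \<or> B dvd 1" using \<open>A \<noteq> 0\<close> \<open>B \<noteq> 0\<close> unit by blast
  qed (rule H0)
qed

lemma monic_quadratic_conv:
  assumes "monic_poly r" "degree r = 2"
  shows "r = [:coeff r 0, coeff r 1, 1:]"
proof (rule poly_eqI)
  fix i
  show "coeff r i = coeff [:coeff r 0, coeff r 1, 1:] i"
    using assms coeff_eq_0[of r i]
    by (auto simp: monic_poly_def coeff_pCons eval_nat_numeral split: nat.split)
qed

text \<open>Here s is the ratio of the other root of q to y, that is q = (t - y)(t - y s). A double
  root means s = 1, and trace zero means s = -1.\<close>

lemma quadratic_with_root:
  fixes p q :: "'a::field poly"
  assumes q: "monic_poly q" "degree q = 2" "poly q y = 0" "y \<noteq> 0"
    and p: "degree p = 2"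
    and alt: "(\<exists>z. order z q = 2) \<or> (poly_tr q = 0 \<and> poly_tr p = 0)"
  obtains s where "q = [:y\<^sup>2 * s, - (y * (1 + s)), 1:]" "s = 1 \<or> (s = - 1 \<and> coeff p 1 = 0)"
proof -
  define q0 q1 where "q0 = coeff q 0" and "q1 = coeff q 1"
  have q_eq: "q = [:q0, q1, 1:]" unfolding q0_def q1_def using monic_quadratic_conv q by blast
  have root: "q0 + y * (q1 + y) = 0" using q(3) by (simp add: q_eq)
  define s where "s = - q1 / y - 1"
  have q1: "q1 = - (y * (1 + s))" using q(4) by (simp add: s_def)
  have "q0 = y\<^sup>2 * s" using root by (simp add: q1 power2_eq_square algebra_simps)
  then have q_s: "q = [:y\<^sup>2 * s, - (y * (1 + s)), 1:]" using q_eq q1 by simp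
  from alt have "s = 1 \<or> (s = - 1 \<and> coeff p 1 = 0)"
  proof
    assume "\<exists>z. order z q = 2"
    then obtain z where "order z q = 2" by blast
    then have "[:- z, 1:] ^ 2 dvd q" using order_1[of z q] by simp
    moreover have "monic_poly ([:- z, 1:] ^ 2)" by (simp add: monic_poly_def power2_eq_square)
    ultimately obtain k where k: "q = [:- z, 1:] ^ 2 * k" "monic_poly k"
      using q(1) monic_poly_mult_cancel by (metis dvdE)
    then have "k \<noteq> 0" by (auto simp: monic_poly_def)
    then have "degree q = 2 + degree k"
      unfolding k(1) by (subst degree_mult_eq) (auto simp: degree_power_eq)
    then obtain c where "k = [:c:]" using q(2) by (auto elim: degree_eq_zeroE)
    then have q_z: "q = [:- z, 1:] ^ 2" using k by (simp add: monic_poly_def)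
    then have "y = z" using q(3) by simp
    then have "q = [:y\<^sup>2, - (2 * y), 1:]" by (simp add: q_z power2_eq_square)
    then have "y\<^sup>2 * s = y\<^sup>2" using q_s by simp
    then show ?thesis using q(4) by simp
  next
    assume tr: "poly_tr q = 0 \<and> poly_tr p = 0"
    then have "q1 = 0" "coeff p 1 = 0" using q(2) p by (auto simp: poly_tr_def q1_def)
    then have "1 + s = 0" using q1 q(4) by simp
    then show ?thesis using \<open>coeff p 1 = 0\<close> by (simp add: add_eq_0_iff)
  qed
  with q_s show thesis by (rule that)
qed

lemma quadratic_rescale:
  fixes A B Y z :: "'c::field"
  shows "Y \<noteq> 0 \<Longrightarrow> A + Y * z * (B + Y * z) = Y\<^sup>2 * (A / Y\<^sup>2 + z * (B / Y + z))"
  by (simp add: field_simps power2_eq_square)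

lemma quadratic_factor:
  fixes x Y S :: "'c::comm_ring_1"
  shows "Y\<^sup>2 * S + x * (- (Y * (1 + S)) + x) = (x - Y) * (x - Y * S)"
  by (simp add: algebra_simps power2_eq_square)

text \<open>The roots of H_y(p) are those of p divided by y. The other root of q is y again, or -y
  with p even; in the latter case Root(p) is stable under negation, so dividing by -y gives the same
  set.\<close>

lemma H_poly_ac_root_iff:
  fixes p q :: "'a::field poly"
  assumes p: "p = [:p0, p1, 1:]" and q: "q = [:y\<^sup>2 * s, - (y * (1 + s)), 1:]"
    and y0: "y \<noteq> 0" and s: "s = 1 \<or> (s = - 1 \<and> p1 = 0)"
  shows "z \<in> {x * inverse y' |x y'. x \<in> ac_roots p \<and> y' \<in> ac_roots q} \<longleftrightarrow>
    poly (map_poly to_ac (H_poly y p)) z = 0"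
proof -
  let ?P = "H_poly y p"
  note P = H_poly_quadratic[OF p y0]
  define Y where "Y = to_ac y"
  have Y0: "Y \<noteq> 0" using y0 by (simp add: Y_def)
  have P_root: "poly (map_poly to_ac ?P) z = 0 \<longleftrightarrow> poly (map_poly to_ac p) (Y * z) = 0" for z
  proof -
    have "poly (map_poly to_ac p) (Y * z) = to_ac p0 + Y * z * (to_ac p1 + Y * z)"
      by (simp add: p to_ac_hom.map_poly_pCons_hom)
    also have "\<dots> = Y\<^sup>2 * (to_ac p0 / Y\<^sup>2 + z * (to_ac p1 / Y + z))"
      by (rule quadratic_rescale[OF Y0])
    also have "to_ac p0 / Y\<^sup>2 + z * (to_ac p1 / Y + z) = poly (map_poly to_ac ?P) z"
      by (simp add: P to_ac_hom.map_poly_pCons_hom Y_def[symmetric])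
    finally show ?thesis using Y0 by simp
  qed
  have q_eval: "poly (map_poly to_ac q) x = (x - Y) * (x - Y * to_ac s)" for x
    unfolding quadratic_factor[symmetric]
    by (simp add: q to_ac_hom.map_poly_pCons_hom Y_def[symmetric])
  show ?thesis
  proof
    assume "z \<in> {x * inverse y' |x y'. x \<in> ac_roots p \<and> y' \<in> ac_roots q}"
    then obtain x y' where z: "z = x * inverse y'" and x: "poly (map_poly to_ac p) x = 0"
      and y': "poly (map_poly to_ac q) y' = 0" by (auto simp: ac_roots_def)
    have "(y' - Y) * (y' - Y * to_ac s) = 0" using y' by (simp only: q_eval)
    then have "y' = Y \<or> y' = - Y \<and> p1 = 0" using s by auto
    then show "poly (map_poly to_ac ?P) z = 0"
    proof
      assume "y' = Y"
      then have "Y * z = x" using Y0 by (simp add: z)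
      then show ?thesis using x P_root by simp
    next
      assume y': "y' = - Y \<and> p1 = 0"
      then have "Y * z = - x" using Y0 by (simp add: z)
      then show ?thesis unfolding P_root using x y' by (simp add: p to_ac_hom.map_poly_pCons_hom)
    qed
  next
    assume "poly (map_poly to_ac ?P) z = 0"
    then have "Y * z \<in> ac_roots p" by (simp add: P_root ac_roots_def)
    moreover have "Y \<in> ac_roots q" by (simp add: ac_roots_def q_eval)
    moreover have "z = (Y * z) * inverse Y" using Y0 by simp
    ultimately show "z \<in> {x * inverse y' |x y'. x \<in> ac_roots p \<and> y' \<in> ac_roots q}" by blast
  qed
qed

theorem theorem4p21:
  fixes scale :: "'a::field \<Rightarrow> 'b::ab_group_add \<Rightarrow> 'b"
    and Basis :: "'b set"
    and p q :: "'a poly"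
    and y :: 'a
    and u :: "'b \<Rightarrow> 'b"
  assumes "finite_dimensional_vector_space scale Basis"
    and "monic_poly p" and "degree p = 2"
    and "monic_poly q" and "degree q = 2"
    and "poly p 0 * poly q 0 \<noteq> 0"
    and "irreducible p"
    and "splits q"
    and "(\<exists>z. order z q = 2) \<or> (poly_tr q = 0 \<and> poly_tr p = 0)"
    and "poly q y = 0"
    and "endomorphism scale u"
  shows "(q_exceptional_pq_quotient scale p q u \<longleftrightarrow>
            (\<exists>n. minimal_polynomial scale u = H_poly y p ^ n)) \<and>
         ((\<exists>n. minimal_polynomial scale u = H_poly y p ^ n) \<longleftrightarrow>
            (\<exists>bs ns. ordered_basis scale bs \<and> (\<forall>n\<in>set ns. 0 < n) \<and>
               matrix_in scale bs u =
                 diag_block_mat (map (\<lambda>n. companion_mat (H_poly y p ^ n)) ns)))"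
proof -
  interpret finite_dimensional_vector_space scale Basis by fact
  have "Vector_Spaces.linear scale scale u" using assms(11) by (simp add: endomorphism_def)
  then interpret fd_endo scale Basis u
    by (intro fd_endo.intro fd_endo_axioms.intro finite_dimensional_vector_space_axioms)
  define P where "P = H_poly y p"
  have y0: "y \<noteq> 0" using assms(6,10) by auto
  define p0 p1 where "p0 = coeff p 0" and "p1 = coeff p 1"
  have p: "p = [:p0, p1, 1:]" unfolding p0_def p1_def using monic_quadratic_conv assms(2,3) by blast
  have P: "P = [:p0 / y\<^sup>2, p1 / y, 1:]" unfolding P_def by (rule H_poly_quadratic[OF p y0])
  have P_props: "irreducible P" "monic_poly P" "degree P > 0"
    using irreducible_H_poly[OF assms(7) y0] by (simp add: P_def, simp_all add: P monic_poly_def)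
  obtain s where q: "q = [:y\<^sup>2 * s, - (y * (1 + s)), 1:]" and s: "s = 1 \<or> (s = - 1 \<and> p1 = 0)"
    using quadratic_with_root[OF assms(4,5,10) y0 assms(3,9)] unfolding p1_def by blast
  have ac_ratio: "z \<in> {x * inverse y' |x y'. x \<in> ac_roots p \<and> y' \<in> ac_roots q} \<longleftrightarrow>
      poly (map_poly to_ac P) z = 0" for z
    unfolding P_def by (rule H_poly_ac_root_iff[OF p q y0 s])
  have i_ii: "\<exists>n. minimal_polynomial scale u = P ^ n" if "q_exceptional_pq_quotient scale p q u"
  proof (rule minimal_polynomial_irreducible_power[OF P_props(1,2)])
    fix z assume "ac_eigenvalue scale u z"
    with that have "z \<in> {x * inverse y' |x y'. x \<in> ac_roots p \<and> y' \<in> ac_roots q}"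
      unfolding q_exceptional_pq_quotient_def q_exceptional_def by blast
    then show "poly (map_poly to_ac P) z = 0" by (simp only: ac_ratio)
  qed
  have ii_iii: "\<exists>bs ns. ordered_basis scale bs \<and> (\<forall>n\<in>set ns. 0 < n) \<and>
      matrix_in scale bs u = diag_block_mat (map (\<lambda>n. companion_mat (P ^ n)) ns)"
    if "minimal_polynomial scale u = P ^ n" for n
  proof -
    have "annihilates scale (P ^ n) u" using minimal_polynomial_props(2)[of "P ^ n"] that by simp
    then show ?thesis using block_companion_of_power[OF P_props] by blast
  qed
  have iii_i: "q_exceptional_pq_quotient scale p q u"
    if bs: "ordered_basis scale bs" and ns: "\<forall>n\<in>set ns. 0 < n"
      and M: "matrix_in scale bs u = diag_block_mat (map (\<lambda>n. companion_mat (P ^ n)) ns)" for bs ns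
  proof -
    have "represents bs (diag_block_mat (map (\<lambda>n. companion_mat (P ^ n)) ns))"
      unfolding matrix_in_eq_iff[OF bs, symmetric] by (rule M)
    then obtain wns where wns: "map snd wns = ns"
      "bs = concat (map (\<lambda>(w, n). chain w (degree (P ^ n))) wns)"
      "\<forall>(w, n)\<in>set wns. act (P ^ n) w = 0"
      unfolding represents_diag_block_companion[OF P_props(2,3) ns] by blast
    have pos: "\<forall>n\<in>set (map snd wns). 0 < n" using ns wns(1) by simp
    note bs' = bs[unfolded wns(2)]
    have nz: "p0 / y\<^sup>2 \<noteq> 0" using assms(6) y0 by (simp add: p)
    \<comment> \<open>The trace \<tau> of P is - p1 / y; multiplying it by y, and the constant term
      by y^2, restores the coefficients of p.\<close>
    have P': "P = [:p0 / y\<^sup>2, - (- p1 / y), 1:]" by (simp add: P)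
    have s': "s = 1 \<or> s = - 1 \<and> - p1 / y = 0" using s by auto
    have "pq_quotient scale [:y\<^sup>2 * (p0 / y\<^sup>2), - (y * (- p1 / y)), 1:]
        [:y\<^sup>2 * s, - (y * (1 + s)), 1:] u"
      by (rule pq_quotient_of_chains[OF P' P_props(1) bs' pos wns(3) y0 nz s'])
    then have "pq_quotient scale p q u" using y0 by (simp add: p q)
    moreover have "q_exceptional scale p q u"
      unfolding q_exceptional_def ac_ratio
    proof (intro allI impI)
      fix z assume z: "ac_eigenvalue scale u z"
      obtain N where "annihilates scale (P ^ N) u" using annihilates_of_chains[OF bs' wns(3)] by blast
      then have "poly (map_poly to_ac (P ^ N)) z = 0" using ac_eigenvalue_root z by blast
      then show "poly (map_poly to_ac P) z = 0" by (simp add: to_ac_poly_hom.hom_power)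
    qed
    ultimately show ?thesis by (simp add: q_exceptional_pq_quotient_def)
  qed
  \<comment> \<open>The maps a and b are built on the generators of the companion blocks, so (ii)
    reaches (i) through (iii).\<close>
  have ii_i: "q_exceptional_pq_quotient scale p q u" if "minimal_polynomial scale u = P ^ n" for n
    using ii_iii[OF that] iii_i by (elim exE conjE)
  show ?thesis
    unfolding P_def[symmetric]
    by (intro conjI iffI; (elim exE conjE)?; (rule i_ii ii_i ii_iii, assumption)?)
      (rule i_ii, rule iii_i)
qed

end
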